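(* (Gelfand theorem) Let $A$ be an $\mathbb{H}$-$B^*$-algebra. Then $A\cong C_0(\Omega;\mathbb{H})$ (as $\mathbb{H}$-$B^*$-algebras) for some locally compact Hausdorff space $\Omega$ if and only if all elements of $A$ are normal (i.e. $a^*a=aa^*$ for every $a\in A$).
   Context: $\mathbb{H}$ denotes the real quaternions with conjugation $^*$ and the Euclidean norm; $\mathbb{R}$ is identified with its center. An $\mathbb{H}$-vector space is a unital $\mathbb{H}$-bimodule $X$ with $rx=xr$ for $r\in\mathbb{R}$; an $\mathbb{H}$-normed space is an $\mathbb{H}$-vector space with a norm satisfying $\|\alpha x\beta\|\le\|\alpha\|\|x\|\|\beta\|$. An $\mathbb{H}$-algebra is an $\mathbb{H}$-vector space $A$ that is also an $\mathbb{R}$-algebra (for the induced real vector space structure; no unit required) with $(\gamma a)b=\gamma(ab)$, $(a\gamma)b=a(\gamma b)$, $(ab)\gamma=a(b\gamma)$ for $a,b\in A$, $\gamma\in\mathbb{H}$. An $\mathbb{H}$-involution on $A$ is a (real) involution with $(\alpha b)^*=b^*\alpha^*$ and $(b\alpha)^*=\alpha^*b^*$ for $\alpha\in\mathbb{H}$, $b\in A$. An $\mathbb{H}$-$B^*$-algebra is an $\mathbb{H}$-algebra with $\mathbb{H}$-involution and a norm making it a complete $\mathbb{H}$-normed space with $\|ab\|\le\|a\|\|b\|$ and $\|a^*a\|=\|a\|^2$. Isomorphism of $\mathbb{H}$-$B^*$-algebras means an isometric bijective $\mathbb{H}$-bimodule map that is multiplicative and $*$-preserving. $C_0(\Omega;\mathbb{H})$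 is the space of continuous functions $\Omega\to\mathbb{H}$ vanishing at infinity, with pointwise operations, pointwise conjugation as involution, and the supremum norm. *)

theory Defs
  imports "HOL-Analysis.Analysis"
begin

section \<open>The real quaternions\<close>

datatype quat = Quat (qRe: real) (qIm1: real) (qIm2: real) (qIm3: real)

lemma quat_eq_iff:
  "p = q \<longleftrightarrow> qRe p = qRe q \<and> qIm1 p = qIm1 q \<and> qIm2 p = qIm2 q \<and> qIm3 p = qIm3 q"
  by (cases p; cases q) auto

instantiation quat :: real_vector
begin

definition "0 = Quat 0 0 0 0"
definition "p + q = Quat (qRe p + qRe q) (qIm1 p + qIm1 q) (qIm2 p + qIm2 q) (qIm3 p + qIm3 q)"
definition "p - q = Quat (qRe p - qRe q) (qIm1 p - qIm1 q) (qIm2 p - qIm2 q) (qIm3 p - qIm3 q)"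
definition "- q = Quat (- qRe q) (- qIm1 q) (- qIm2 q) (- qIm3 q)"
definition "r *\<^sub>R q = Quat (r * qRe q) (r * qIm1 q) (r * qIm2 q) (r * qIm3 q)"

instance
  by standard
    (simp_all add: quat_eq_iff zero_quat_def plus_quat_def minus_quat_def uminus_quat_def
      scaleR_quat_def algebra_simps)

end

lemmas quat_vector_defs =
  zero_quat_def plus_quat_def minus_quat_def uminus_quat_def scaleR_quat_def

instantiation quat :: real_inner
begin

definition "inner p q = qRe p * qRe q + qIm1 p * qIm1 q + qIm2 p * qIm2 q + qIm3 p * qIm3 q"
definition "norm (q :: quat) = sqrt ((qRe q)\<^sup>2 + (qIm1 q)\<^sup>2 + (qIm2 q)\<^sup>2 + (qIm3 q)\<^sup>2)"
definition "sgn (q :: quat) = q /\<^sub>R norm q"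
definition "dist (p :: quat) q = norm (p - q)"
definition
  "(uniformity :: (quat \<times> quat) filter) = (INF e\<in>{0<..}. principal {(x, y). dist x y < e})"
definition
  "open (U :: quat set) \<longleftrightarrow> (\<forall>x\<in>U. \<forall>\<^sub>F (x', y) in uniformity. x' = x \<longrightarrow> y \<in> U)"

instance
proof
  fix p q s :: quat and r :: real
  show "inner p q = inner q p"
    by (simp add: inner_quat_def algebra_simps)
  show "inner (p + q) s = inner p s + inner q s"
    by (simp add: inner_quat_def plus_quat_def algebra_simps)
  show "inner (r *\<^sub>R p) q = r * inner p q"
    by (simp add: inner_quat_def scaleR_quat_def algebra_simps)
  show "0 \<le> inner p p"
    by (simp add: inner_quat_def)
  show "inner p p = 0 \<longleftrightarrow> p = 0"
    by (simp add: inner_quat_def zero_quat_def quat_eq_iff add_nonneg_eq_0_iff)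
  show "norm p = sqrt (inner p p)"
    by (simp add: inner_quat_def norm_quat_def power2_eq_square)
qed (rule sgn_quat_def dist_quat_def uniformity_quat_def open_quat_def)+

end

instantiation quat :: euclidean_space
begin

definition "Basis = {Quat 1 0 0 0, Quat 0 1 0 0, Quat 0 0 1 0, Quat 0 0 0 1}"

instance
proof
  show "(Basis :: quat set) \<noteq> {}" "finite (Basis :: quat set)"
    by (simp_all add: Basis_quat_def)
  have "\<forall>u\<in>Basis. \<forall>v\<in>Basis. inner u v = (if u = (v :: quat) then 1 else 0)"
    unfolding Basis_quat_def by (simp add: inner_quat_def)
  then show "inner u v = (if u = v then 1 else 0)" if "u \<in> Basis" "v \<in> Basis" for u v :: quat
    using that by blast
  show "(\<forall>u\<in>Basis. inner x u = 0) \<longleftrightarrow> x = 0" for x :: quat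
    by (cases x) (simp add: Basis_quat_def inner_quat_def zero_quat_def)
qed

end

text \<open>The product is determined by \<open>i\<^sup>2 = j\<^sup>2 = k\<^sup>2 = ijk = -1\<close>.\<close>

instantiation quat :: real_normed_div_algebra
begin

definition "1 = Quat 1 0 0 0"
definition "p * q = Quat
  (qRe p * qRe q - qIm1 p * qIm1 q - qIm2 p * qIm2 q - qIm3 p * qIm3 q)
  (qRe p * qIm1 q + qIm1 p * qRe q + qIm2 p * qIm3 q - qIm3 p * qIm2 q)
  (qRe p * qIm2 q - qIm1 p * qIm3 q + qIm2 p * qRe q + qIm3 p * qIm1 q)
  (qRe p * qIm3 q + qIm1 p * qIm2 q - qIm2 p * qIm1 q + qIm3 p * qRe q)"
definition "inverse (q :: quat) =
  (1 / (norm q)\<^sup>2) *\<^sub>R Quat (qRe q) (- qIm1 q) (- qIm2 q) (- qIm3 q)"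
definition "p div (q :: quat) = p * inverse q"

instance
proof
  fix p q s :: quat and r :: real
  show "p * q * s = p * (q * s)" "(p + q) * s = p * s + q * s" "p * (q + s) = p * q + p * s"
    "r *\<^sub>R p * q = r *\<^sub>R (p * q)" "p * r *\<^sub>R q = r *\<^sub>R (p * q)"
    "1 * p = p" "p * 1 = p" "(0::quat) \<noteq> 1"
    by (simp_all add: quat_eq_iff times_quat_def one_quat_def quat_vector_defs algebra_simps)
  have n2: "(norm x)\<^sup>2 = (qRe x)\<^sup>2 + (qIm1 x)\<^sup>2 + (qIm2 x)\<^sup>2 + (qIm3 x)\<^sup>2" for x :: quat
    by (simp add: norm_quat_def)
  have "(norm (p * q))\<^sup>2 = (norm p * norm q)\<^sup>2"
    unfolding power_mult_distrib n2 by (simp add: times_quat_def power2_eq_square algebra_simps)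
  then show "norm (p * q) = norm p * norm q"
    by simp
  show "p div q = p * inverse q"
    by (rule divide_quat_def)
  show "inverse (0::quat) = 0"
    by (simp add: inverse_quat_def zero_quat_def scaleR_quat_def)
  assume "p \<noteq> 0"
  define c where "c = Quat (qRe p) (- qIm1 p) (- qIm2 p) (- qIm3 p)"
  have "p * c = (norm p)\<^sup>2 *\<^sub>R 1" "c * p = (norm p)\<^sup>2 *\<^sub>R 1"
    unfolding n2
    by (simp_all add: c_def quat_eq_iff times_quat_def one_quat_def scaleR_quat_def
        power2_eq_square algebra_simps)
  moreover have "x * (r *\<^sub>R y) = r *\<^sub>R (x * y)" "(r *\<^sub>R x) * y = r *\<^sub>R (x * y)" for r and x y :: quat
    by (simp_all add: quat_eq_iff times_quat_def scaleR_quat_def algebra_simps)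
  ultimately show "inverse p * p = 1" "p * inverse p = 1"
    using \<open>p \<noteq> 0\<close> by (simp_all add: inverse_quat_def flip: c_def)
qed

end

definition qcnj :: "quat \<Rightarrow> quat" where
  "qcnj q = Quat (qRe q) (- qIm1 q) (- qIm2 q) (- qIm3 q)"


section \<open>Quaternionic \<open>B\<^sup>*\<close>-algebras\<close>

text \<open>
  The reals sit in the quaternions via \<^const>\<open>of_real\<close>.  The two axioms about \<^const>\<open>of_real\<close>
  say that both actions of a real scalar are the ambient real scalar multiplication; they comprise
  unitality (\<open>r = 1\<close>), \<open>r x = x r\<close>, and the fact that the real vector space structure of the type
  is the one induced by the bimodule structure.
\<close>

locale quat_vector_space =
  fixes lscale :: "quat \<Rightarrow> 'a::real_vector \<Rightarrow> 'a"
    and rscale :: "'a \<Rightarrow> quat \<Rightarrow> 'a"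
  assumes lscale_add_right: "lscale \<alpha> (x + y) = lscale \<alpha> x + lscale \<alpha> y"
    and lscale_add_left: "lscale (\<alpha> + \<beta>) x = lscale \<alpha> x + lscale \<beta> x"
    and lscale_lscale: "lscale \<alpha> (lscale \<beta> x) = lscale (\<alpha> * \<beta>) x"
    and rscale_add_left: "rscale (x + y) \<alpha> = rscale x \<alpha> + rscale y \<alpha>"
    and rscale_add_right: "rscale x (\<alpha> + \<beta>) = rscale x \<alpha> + rscale x \<beta>"
    and rscale_rscale: "rscale (rscale x \<alpha>) \<beta> = rscale x (\<alpha> * \<beta>)"
    and lscale_rscale: "lscale \<alpha> (rscale x \<beta>) = rscale (lscale \<alpha> x) \<beta>"
    and lscale_of_real: "lscale (of_real r) x = r *\<^sub>R x"
    and rscale_of_real: "rscale x (of_real r) = r *\<^sub>R x"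

locale quat_normed_space = quat_vector_space lscale rscale
  for lscale :: "quat \<Rightarrow> 'a::real_normed_vector \<Rightarrow> 'a" and rscale :: "'a \<Rightarrow> quat \<Rightarrow> 'a" +
  assumes norm_scale_le: "norm (rscale (lscale \<alpha> x) \<beta>) \<le> norm \<alpha> * norm x * norm \<beta>"

locale quat_algebra = quat_vector_space lscale rscale
  for lscale :: "quat \<Rightarrow> 'a::real_algebra \<Rightarrow> 'a" and rscale :: "'a \<Rightarrow> quat \<Rightarrow> 'a" +
  assumes lscale_mult: "lscale \<gamma> a * b = lscale \<gamma> (a * b)"
    and rscale_mult_lscale: "rscale a \<gamma> * b = a * lscale \<gamma> b"
    and mult_rscale: "rscale (a * b) \<gamma> = a * rscale b \<gamma>"

locale quat_involution = quat_algebra lscale rscale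
  for lscale :: "quat \<Rightarrow> 'a::real_algebra \<Rightarrow> 'a" and rscale :: "'a \<Rightarrow> quat \<Rightarrow> 'a" +
  fixes star :: "'a \<Rightarrow> 'a"
  assumes star_star: "star (star a) = a"
    and star_add: "star (a + b) = star a + star b"
    and star_scaleR: "star (r *\<^sub>R a) = r *\<^sub>R star a"
    and star_mult: "star (a * b) = star b * star a"
    and star_lscale: "star (lscale \<alpha> b) = rscale (star b) (qcnj \<alpha>)"
    and star_rscale: "star (rscale b \<alpha>) = lscale (qcnj \<alpha>) (star b)"

text \<open>
  Completeness and submultiplicativity of the norm are part of the sort
  \<open>{banach, real_normed_algebra}\<close>, which does not require a unit.
\<close>

locale quat_Bstar_algebra =
  quat_normed_space lscale rscale + quat_involution lscale rscale star
  for lscale :: "quat \<Rightarrow> 'a::{banach, real_normed_algebra} \<Rightarrow> 'a"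
    and rscale :: "'a \<Rightarrow> quat \<Rightarrow> 'a"
    and star :: "'a \<Rightarrow> 'a" +
  assumes norm_star_mult_self: "norm (star a * a) = (norm a)\<^sup>2"


section \<open>Continuous quaternion-valued functions vanishing at infinity\<close>

text \<open>
  \<open>\<Omega>\<close> is a topology on a subset of a type, so functions on \<open>\<Omega>\<close> are represented by their extensional
  representatives (\<^const>\<open>undefined\<close> outside \<open>topspace \<Omega>\<close>).
\<close>

definition C0 :: "'b topology \<Rightarrow> ('b \<Rightarrow> quat) set" where
  "C0 \<Omega> = {f \<in> extensional (topspace \<Omega>).
     continuous_map \<Omega> euclidean f \<and>
     (\<forall>e>0. \<exists>K. compactin \<Omega> K \<and> (\<forall>x \<in> topspace \<Omega> - K. norm (f x) < e))}"

text \<open>Inserting \<open>0\<close> only matters for empty \<open>\<Omega>\<close>, where the real supremum of \<open>{}\<close> is unspecified.\<close>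

definition C0_norm :: "'b topology \<Rightarrow> ('b \<Rightarrow> quat) \<Rightarrow> real" where
  "C0_norm \<Omega> f = Sup (insert 0 ((\<lambda>x. norm (f x)) ` topspace \<Omega>))"

definition C0_isomorphism ::
    "(quat \<Rightarrow> 'a::real_normed_algebra \<Rightarrow> 'a) \<Rightarrow> ('a \<Rightarrow> quat \<Rightarrow> 'a) \<Rightarrow> ('a \<Rightarrow> 'a) \<Rightarrow>
      'b topology \<Rightarrow> ('a \<Rightarrow> 'b \<Rightarrow> quat) \<Rightarrow> bool" where
  "C0_isomorphism lscale rscale star \<Omega> \<Phi> \<longleftrightarrow>
     bij_betw \<Phi> UNIV (C0 \<Omega>) \<and>
     (\<forall>a b. \<Phi> (a + b) = (\<lambda>x\<in>topspace \<Omega>. \<Phi> a x + \<Phi> b x)) \<and>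
     (\<forall>\<alpha> a. \<Phi> (lscale \<alpha> a) = (\<lambda>x\<in>topspace \<Omega>. \<alpha> * \<Phi> a x)) \<and>
     (\<forall>a \<alpha>. \<Phi> (rscale a \<alpha>) = (\<lambda>x\<in>topspace \<Omega>. \<Phi> a x * \<alpha>)) \<and>
     (\<forall>a b. \<Phi> (a * b) = (\<lambda>x\<in>topspace \<Omega>. \<Phi> a x * \<Phi> b x)) \<and>
     (\<forall>a. \<Phi> (star a) = (\<lambda>x\<in>topspace \<Omega>. qcnj (\<Phi> a x))) \<and>
     (\<forall>a. C0_norm \<Omega> (\<Phi> a) = norm a)"

definition C0_isomorphic ::
    "(quat \<Rightarrow> 'a::real_normed_algebra \<Rightarrow> 'a) \<Rightarrow> ('a \<Rightarrow> quat \<Rightarrow> 'a) \<Rightarrow> ('a \<Rightarrow> 'a) \<Rightarrow>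
      'b topology \<Rightarrow> bool" where
  "C0_isomorphic lscale rscale star \<Omega> \<longleftrightarrow> (\<exists>\<Phi>. C0_isomorphism lscale rscale star \<Omega> \<Phi>)"

end

theory Submission
  imports Defs
begin

text \<open>
  The functions in \<open>C\<^sub>0(\<Omega>; \<real>)\<close> are exactly the elements of \<open>C\<^sub>0(\<Omega>; H)\<close> that commute with all
  quaternions, so the centre \<open>Z = {x. \<gamma> x = x \<gamma> for all \<gamma>}\<close> of an algebra \<open>A\<close> of normal elements has to be
  recognised as a real function algebra.  Every bimodule splits as
  \<open>A = Z \<oplus> iZ \<oplus> jZ \<oplus> kZ\<close>, the component in \<open>Z\<close> being \<open>(a - iai - jaj - kak) / 4\<close>, a
  contraction.  Evaluating the polarised identity \<open>a\<^sup>* b + b\<^sup>* a = a b\<^sup>* + b a\<^sup>*\<close> at \<open>(x, y)\<close>,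
  \<open>(x, iy)\<close> and \<open>(ix, jy)\<close> with \<open>x, y \<in> Z\<close> yields \<open>x\<^sup>* y = y x\<^sup>* = y\<^sup>* x\<close>.  For the skew element
  \<open>n = x\<^sup>* - x\<close> this gives \<open>n\<^sup>3 = 0\<close>, whence \<open>n = 0\<close>: on \<open>Z\<close> the involution is trivial and the
  product commutative (\<open>star_centre_id\<close>).  The \<open>B\<^sup>*\<close>-identity becomes \<open>\<parallel>x\<^sup>2\<parallel> = \<parallel>x\<parallel>\<^sup>2\<close>, and applied to
  \<open>x + iy\<close> it gives \<open>\<parallel>x\<^sup>2\<parallel> \<le> \<parallel>x\<^sup>2 + y\<^sup>2\<parallel>\<close>.

  In a commutative real algebra these two norm relations provide enough real characters
  (\<open>exists_norming_character\<close>).  Given \<open>b\<close> with \<open>\<parallel>b\<parallel> = 1\<close>, consider the seminorms \<open>p \<le> \<parallel>\<cdot>\<parallel>\<close> that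
  satisfy the same relations and \<open>p b = 1\<close>.  By Zorn's lemma there is a minimal one.  For \<open>p c > 0\<close> the
  limit of \<open>p (x c\<^sub>k) / p c\<^sub>k\<close> along \<open>c\<^sub>k = c\<^bsup>2^k\<^esup>\<close> is a seminorm below \<open>p\<close> with the same relations.  It
  also has the value \<open>1\<close> at \<open>b\<close>, as is seen first for \<open>c = b\<close> and then for all \<open>c\<close>, so minimality forces
  \<open>p (x c) = p x p c\<close>.  A multiplicative seminorm obeying \<open>p (x\<^sup>2) \<le> p (x\<^sup>2 + y\<^sup>2)\<close> is additive on
  squares, and by the parallelogram identity for \<open>x\<^sup>2\<close> and \<open>y\<^sup>2\<close> the equality \<open>p x = p y\<close> implies
  \<open>p (x - y) = 0\<close> or \<open>p (x + y) = 0\<close>.  Hence modulo its null space only one dimension is left, and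
  \<open>p\<close> is the absolute value of a character.

  Characters of \<open>Z\<close> extend to \<open>H\<close>-valued characters of \<open>A\<close>, and since \<open>a\<^sup>* a \<in> Z\<close> every \<open>a\<close> has a
  norming one.  The nonzero characters, with the topology of pointwise convergence, form the space
  \<open>\<Omega>\<close>; adjoining the zero character makes it compact.  Evaluation is then an isometry into
  \<open>C\<^sub>0(\<Omega>; H)\<close>, and it is onto because its range is complete and, by the Stone--Weierstrass theorem
  applied to each of the four components, dense (\<open>gelfand_isomorphism\<close>).  The converse holds because
  \<open>q\<^sup>* q = q q\<^sup>*\<close> for every quaternion \<open>q\<close>.
\<close>

section \<open>Seminorms on real function algebras\<close>

text \<open>
  The norm relations characterise, among the commutative real normed algebras, those that embed
  isometrically into an algebra of real-valued functions.  The second relation rules out complex values,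
  where \<open>1\<^sup>2 + i\<^sup>2 = 0\<close>.
\<close>

locale real_function_algebra =
  fixes B :: "'a::real_normed_algebra set"
  assumes subspace: "subspace B"
    and mult_closed: "x \<in> B \<Longrightarrow> y \<in> B \<Longrightarrow> x * y \<in> B"
    and commute: "x \<in> B \<Longrightarrow> y \<in> B \<Longrightarrow> x * y = y * x"
    and norm_square: "x \<in> B \<Longrightarrow> norm (x * x) = (norm x)\<^sup>2"
    and norm_square_le_add: "x \<in> B \<Longrightarrow> y \<in> B \<Longrightarrow> norm (x * x) \<le> norm (x * x + y * y)"
begin

lemmas add_closed = subspace_add [OF subspace]
  and scale_closed = subspace_scale [OF subspace]
  and diff_closed = subspace_diff [OF subspace]

lemma mult_left_commute: "x \<in> B \<Longrightarrow> y \<in> B \<Longrightarrow> z \<in> B \<Longrightarrow> x * (y * z) = y * (x * z)"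
  by (metis commute mult.assoc)

text \<open>
  Values outside \<open>B\<close> are normalised to \<open>0\<close>, so that such a seminorm is determined by its restriction to
  \<open>B\<close> and the pointwise order can have minimal elements.
\<close>

definition square_seminorm :: "('a \<Rightarrow> real) \<Rightarrow> bool" where
  "square_seminorm p \<longleftrightarrow>
     (\<forall>x. x \<notin> B \<longrightarrow> p x = 0) \<and>
     (\<forall>x\<in>B. 0 \<le> p x \<and> p x \<le> norm x \<and> p (x * x) = (p x)\<^sup>2) \<and>
     (\<forall>r. \<forall>x\<in>B. p (r *\<^sub>R x) = \<bar>r\<bar> * p x) \<and>
     (\<forall>x\<in>B. \<forall>y\<in>B. p (x + y) \<le> p x + p y \<and> p (x * y) \<le> p x * p y \<and>
        p (x * x) \<le> p (x * x + y * y))"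

lemma square_seminormI:
  assumes "\<And>x. x \<notin> B \<Longrightarrow> p x = 0"
    and "\<And>x. x \<in> B \<Longrightarrow> 0 \<le> p x" "\<And>x. x \<in> B \<Longrightarrow> p x \<le> norm x"
    and "\<And>x. x \<in> B \<Longrightarrow> p (x * x) = (p x)\<^sup>2"
    and "\<And>r x. x \<in> B \<Longrightarrow> p (r *\<^sub>R x) = \<bar>r\<bar> * p x"
    and "\<And>x y. x \<in> B \<Longrightarrow> y \<in> B \<Longrightarrow> p (x + y) \<le> p x + p y"
    and "\<And>x y. x \<in> B \<Longrightarrow> y \<in> B \<Longrightarrow> p (x * y) \<le> p x * p y"
    and "\<And>x y. x \<in> B \<Longrightarrow> y \<in> B \<Longrightarrow> p (x * x) \<le> p (x * x + y * y)"
  shows "square_seminorm p"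
  using assms unfolding square_seminorm_def by blast

lemma
  assumes "square_seminorm p"
  shows seminorm_outside: "x \<notin> B \<Longrightarrow> p x = 0"
    and seminorm_nonneg: "0 \<le> p x"
    and seminorm_le_norm: "p x \<le> norm x"
    and seminorm_square: "x \<in> B \<Longrightarrow> p (x * x) = (p x)\<^sup>2"
    and seminorm_scaleR: "x \<in> B \<Longrightarrow> p (r *\<^sub>R x) = \<bar>r\<bar> * p x"
    and seminorm_triangle: "x \<in> B \<Longrightarrow> y \<in> B \<Longrightarrow> p (x + y) \<le> p x + p y"
    and seminorm_mult_le: "x \<in> B \<Longrightarrow> y \<in> B \<Longrightarrow> p (x * y) \<le> p x * p y"
    and seminorm_square_le_add: "x \<in> B \<Longrightarrow> y \<in> B \<Longrightarrow> p (x * x) \<le> p (x * x + y * y)"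
proof -
  show "x \<notin> B \<Longrightarrow> p x = 0" "x \<in> B \<Longrightarrow> p (x * x) = (p x)\<^sup>2"
    "x \<in> B \<Longrightarrow> p (r *\<^sub>R x) = \<bar>r\<bar> * p x"
    "x \<in> B \<Longrightarrow> y \<in> B \<Longrightarrow> p (x + y) \<le> p x + p y"
    "x \<in> B \<Longrightarrow> y \<in> B \<Longrightarrow> p (x * y) \<le> p x * p y"
    "x \<in> B \<Longrightarrow> y \<in> B \<Longrightarrow> p (x * x) \<le> p (x * x + y * y)"
    using assms unfolding square_seminorm_def by blast+
  show "0 \<le> p x" "p x \<le> norm x"
    using assms unfolding square_seminorm_def by (cases "x \<in> B"; simp)+
qed

lemma square_seminorm_norm: "square_seminorm (\<lambda>x. if x \<in> B then norm x else 0)"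
  by (rule square_seminormI)
    (auto simp: mult_closed add_closed scale_closed norm_triangle_ineq norm_mult_ineq
      norm_square_le_add intro: norm_square)

section \<open>Localising a seminorm at an element\<close>

text \<open>
  The powers \<open>c\<^bsup>2^k\<^esup>\<close> avoid the missing unit, and \<open>p (c\<^bsup>2^k\<^esup>)\<close> is known exactly because \<open>p\<close>
  commutes with squaring.
\<close>

primrec square_iterate :: "'a \<Rightarrow> nat \<Rightarrow> 'a" where
  "square_iterate c 0 = c"
| "square_iterate c (Suc k) = square_iterate c k * square_iterate c k"

lemma square_iterate_closed: "c \<in> B \<Longrightarrow> square_iterate c k \<in> B"
  by (induction k) (auto simp: mult_closed)

lemma seminorm_square_iterate_pos:
  assumes "square_seminorm p" "c \<in> B" "0 < p c"
  shows "0 < p (square_iterate c k)"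
  by (induction k) (use assms in \<open>auto simp: seminorm_square square_iterate_closed\<close>)

text \<open>
  The largest seminorm below \<open>p\<close> for which multiplication by \<open>c\<close> scales by the factor \<open>p c\<close>.  For the
  supremum norm \<open>p\<close> on \<open>C\<^sub>0(\<Omega>; \<real>)\<close> it is the supremum over the points at which \<open>\<bar>c\<bar>\<close> attains its
  maximum.
\<close>

definition localised :: "('a \<Rightarrow> real) \<Rightarrow> 'a \<Rightarrow> 'a \<Rightarrow> real" where
  "localised p c x =
     (if x \<in> B then lim (\<lambda>k. p (x * square_iterate c k) / p (square_iterate c k)) else 0)"

text \<open>
  Passing from \<open>k\<close> to \<open>k + 1\<close> multiplies both \<open>x c\<^sub>k\<close> and \<open>c\<^sub>k\<close> by \<open>c\<^sub>k\<close>; the denominator picks up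
  exactly \<open>p c\<^sub>k\<close>, the numerator at most that.
\<close>

lemma localised_decseq:
  assumes p: "square_seminorm p" and c: "c \<in> B" "0 < p c" and x: "x \<in> B"
  shows "decseq (\<lambda>k. p (x * square_iterate c k) / p (square_iterate c k))"
proof (rule decseq_SucI)
  fix k
  let ?c = "square_iterate c k"
  have "p (x * ?c * ?c) \<le> p (x * ?c) * p ?c"
    by (intro seminorm_mult_le p mult_closed x square_iterate_closed c)
  then show "p (x * square_iterate c (Suc k)) / p (square_iterate c (Suc k)) \<le> p (x * ?c) / p ?c"
    using seminorm_square_iterate_pos [OF p c, of k]
    by (simp add: seminorm_square [OF p square_iterate_closed [OF c(1)]] power2_eq_square
        divide_simps mult.assoc [where 'a='a])
qed

lemma localised_tendsto:
  assumes p: "square_seminorm p" and c: "c \<in> B" "0 < p c" and x: "x \<in> B"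
  shows "(\<lambda>k. p (x * square_iterate c k) / p (square_iterate c k)) \<longlonglongrightarrow> localised p c x"
proof -
  have "convergent (\<lambda>k. p (x * square_iterate c k) / p (square_iterate c k))"
    using decseq_convergent [OF localised_decseq [OF assms], of 0]
    by (metis convergentI divide_nonneg_nonneg p seminorm_nonneg)
  then show ?thesis
    by (simp add: localised_def x convergent_LIMSEQ_iff)
qed

lemma localised_le_quotient:
  assumes p: "square_seminorm p" and c: "c \<in> B" "0 < p c" and x: "x \<in> B"
  shows "localised p c x \<le> p (x * square_iterate c k) / p (square_iterate c k)"
  using decseq_ge [OF localised_decseq [OF assms] localised_tendsto [OF assms]] .

lemma localised_ge:
  assumes p: "square_seminorm p" and c: "c \<in> B" "0 < p c" and x: "x \<in> B"
    and ge: "\<And>k. r * p (square_iterate c k) \<le> p (x * square_iterate c k)"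
  shows "r \<le> localised p c x"
proof (rule LIMSEQ_le_const [OF localised_tendsto [OF p c x]], intro exI allI impI)
  fix k
  show "r \<le> p (x * square_iterate c k) / p (square_iterate c k)"
    using ge [of k] seminorm_square_iterate_pos [OF p c, of k] by (simp add: divide_simps)
qed

lemma localised_le:
  assumes p: "square_seminorm p" and c: "c \<in> B" "0 < p c"
  shows "localised p c x \<le> p x"
proof (cases "x \<in> B")
  case True
  have "p (x * c) / p c \<le> p x"
    using seminorm_mult_le [OF p True c(1)] c(2) by (simp add: divide_simps)
  with localised_le_quotient [OF p c True, of 0] show ?thesis
    by simp
qed (simp add: localised_def seminorm_nonneg [OF p])

text \<open>
  The relations that involve two factors survive the limit because a product or a square at stage
  \<open>k + 1\<close> is a product or a square of elements at stage \<open>k\<close>: \<open>x y c\<^bsub>k+1\<^esub> = (x c\<^sub>k) (y c\<^sub>k)\<close>.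
\<close>

lemma square_seminorm_localised:
  assumes p: "square_seminorm p" and c: "c \<in> B" "0 < p c"
  shows "square_seminorm (localised p c)"
proof (rule square_seminormI)
  let ?c = "square_iterate c"
  let ?f = "\<lambda>x k. p (x * ?c k) / p (?c k)"
  note lim = localised_tendsto [OF p c]
  have cB: "?c k \<in> B" for k
    by (rule square_iterate_closed [OF c(1)])
  have pos: "0 < p (?c k)" for k
    by (rule seminorm_square_iterate_pos [OF p c])
  have pSuc: "p (?c (Suc k)) = p (?c k) * p (?c k)" for k
    by (simp add: seminorm_square [OF p cB] power2_eq_square)
  have shuffle: "x * y * ?c (Suc k) = (x * ?c k) * (y * ?c k)" if "x \<in> B" "y \<in> B" for x y k
    using that cB [of k] by (simp add: mult.assoc mult_left_commute [of y "?c k"] mult_closed)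
  have lim2: "(\<lambda>k. ?f x (Suc k)) \<longlonglongrightarrow> localised p c x" if "x \<in> B" for x
    using LIMSEQ_Suc [OF lim [OF that]] .
  fix x
  show "localised p c x = 0" if "x \<notin> B"
    using that by (simp add: localised_def)
  assume x: "x \<in> B"
  show "0 \<le> localised p c x"
    by (rule localised_ge [OF p c x]) (simp add: seminorm_nonneg [OF p])
  show "localised p c x \<le> norm x"
    using localised_le [OF p c, of x] seminorm_le_norm [OF p, of x] by linarith
  show "localised p c (x * x) = (localised p c x)\<^sup>2"
  proof (rule LIMSEQ_unique [OF lim2 [OF mult_closed [OF x x]]])
    have "?f (x * x) (Suc k) = (?f x k)\<^sup>2" for k
      unfolding shuffle [OF x x] pSuc seminorm_square [OF p mult_closed [OF x cB]]
      by (simp add: power2_eq_square)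
    then show "(\<lambda>k. ?f (x * x) (Suc k)) \<longlonglongrightarrow> (localised p c x)\<^sup>2"
      by (simp only:) (intro tendsto_intros lim x)
  qed
  show "localised p c (r *\<^sub>R x) = \<bar>r\<bar> * localised p c x" for r
  proof (rule LIMSEQ_unique [OF lim [OF scale_closed [OF x]]])
    have "?f (r *\<^sub>R x) k = \<bar>r\<bar> * ?f x k" for k
      by (simp add: seminorm_scaleR [OF p mult_closed [OF x cB]])
    then show "(\<lambda>k. ?f (r *\<^sub>R x) k) \<longlonglongrightarrow> \<bar>r\<bar> * localised p c x"
      by (simp only:) (intro tendsto_intros lim x)
  qed
  fix y
  assume y: "y \<in> B"
  show "localised p c (x + y) \<le> localised p c x + localised p c y"
  proof (rule LIMSEQ_le [OF lim [OF add_closed [OF x y]] tendsto_add [OF lim [OF x] lim [OF y]]],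
      intro exI allI impI)
    fix k
    show "?f (x + y) k \<le> ?f x k + ?f y k"
      using seminorm_triangle [OF p mult_closed [OF x cB] mult_closed [OF y cB], of k k] pos [of k]
      by (simp add: distrib_right divide_simps)
  qed
  show "localised p c (x * y) \<le> localised p c x * localised p c y"
  proof (rule LIMSEQ_le [OF lim2 [OF mult_closed [OF x y]] tendsto_mult [OF lim [OF x] lim [OF y]]],
      intro exI allI impI)
    fix k
    show "?f (x * y) (Suc k) \<le> ?f x k * ?f y k"
      unfolding shuffle [OF x y] pSuc
      using seminorm_mult_le [OF p mult_closed [OF x cB] mult_closed [OF y cB], of k k] pos [of k]
      by (simp add: divide_simps)
  qed
  show "localised p c (x * x) \<le> localised p c (x * x + y * y)"
  proof (rule LIMSEQ_le [OF lim2 [OF mult_closed [OF x x]]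
        lim2 [OF add_closed [OF mult_closed [OF x x] mult_closed [OF y y]]]],
      intro exI allI impI)
    fix k
    show "?f (x * x) (Suc k) \<le> ?f (x * x + y * y) (Suc k)"
      unfolding distrib_right shuffle [OF x x] shuffle [OF y y]
      using seminorm_square_le_add [OF p mult_closed [OF x cB] mult_closed [OF y cB], of k k]
        pos [of "Suc k"]
      by (simp only: divide_right_mono less_imp_le)
  qed
qed

section \<open>Minimal seminorms\<close>

text \<open>
  Along the filter generated by the lower segments of the chain the seminorms converge pointwise to
  their infimum, so every defining equation and inequality passes to the limit.
\<close>

lemma square_seminorm_chain_Inf:
  assumes C: "\<And>p. p \<in> C \<Longrightarrow> square_seminorm p" and "C \<noteq> {}"
    and chain: "\<And>p q. p \<in> C \<Longrightarrow> q \<in> C \<Longrightarrow> p \<le> q \<or> q \<le> p"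
  shows "square_seminorm (\<lambda>x. INF p\<in>C. p x)"
proof -
  define u where "u x = (INF p\<in>C. p x)" for x
  define F where "F = (INF p\<in>C. principal {q \<in> C. q \<le> p})"
  have ev: "eventually P F \<longleftrightarrow> (\<exists>p\<in>C. \<forall>q\<in>C. q \<le> p \<longrightarrow> P q)" for P
    unfolding F_def
  proof (subst eventually_INF_base)
    fix a b
    assume "a \<in> C" "b \<in> C"
    then show "\<exists>x\<in>C. principal {q \<in> C. q \<le> x}
        \<le> inf (principal {q \<in> C. q \<le> a}) (principal {q \<in> C. q \<le> b})"
      using chain [of a b] by (auto intro: order_trans)
  qed (use \<open>C \<noteq> {}\<close> in \<open>auto simp: eventually_principal\<close>)
  have F: "F \<noteq> bot"
    unfolding trivial_limit_def ev by auto
  have bdd: "bdd_below ((\<lambda>p. p x) ` C)" for x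
    by (rule bdd_belowI [of _ 0]) (auto simp: C seminorm_nonneg)
  have lim: "((\<lambda>p. p x) \<longlongrightarrow> u x) F" for x
  proof (rule order_tendstoI)
    fix a
    assume "a < u x"
    then have "a < p x" if "p \<in> C" for p
      using cINF_lower [OF bdd that, of x] unfolding u_def by linarith
    then show "\<forall>\<^sub>F p in F. a < p x"
      using \<open>C \<noteq> {}\<close> by (auto simp: ev)
  next
    fix a
    assume "u x < a"
    then obtain p where "p \<in> C" "p x < a"
      using cINF_less_iff [OF \<open>C \<noteq> {}\<close> bdd, of x] unfolding u_def by blast
    then show "\<forall>\<^sub>F p in F. p x < a"
      unfolding ev by (meson le_fun_def order_le_less_trans)
  qed
  have evC: "eventually P F" if "\<And>p. square_seminorm p \<Longrightarrow> P p" for P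
    using \<open>C \<noteq> {}\<close> that C by (auto simp: ev)
  have "square_seminorm u"
  proof (rule square_seminormI)
    show "u x = 0" if "x \<notin> B" for x
      using \<open>C \<noteq> {}\<close> by (simp add: u_def seminorm_outside [OF C that])
    show "0 \<le> u x" for x
      by (rule tendsto_lowerbound [OF lim evC F]) (rule seminorm_nonneg)
    show "u x \<le> norm x" for x
      by (rule tendsto_upperbound [OF lim evC F]) (rule seminorm_le_norm)
    show "u (x * x) = (u x)\<^sup>2" if "x \<in> B" for x
    proof (rule tendsto_unique [OF F lim])
      show "((\<lambda>p. p (x * x)) \<longlongrightarrow> (u x)\<^sup>2) F"
        by (rule Lim_transform_eventually [OF tendsto_power [OF lim]])
          (auto intro!: evC simp: seminorm_square that)
    qed
    show "u (r *\<^sub>R x) = \<bar>r\<bar> * u x" if "x \<in> B" for r x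
    proof (rule tendsto_unique [OF F lim])
      show "((\<lambda>p. p (r *\<^sub>R x)) \<longlongrightarrow> \<bar>r\<bar> * u x) F"
        by (rule Lim_transform_eventually [OF tendsto_mult [OF tendsto_const lim]])
          (auto intro!: evC simp: seminorm_scaleR that)
    qed
    show "u (x + y) \<le> u x + u y" if "x \<in> B" "y \<in> B" for x y
      by (rule tendsto_le [OF F tendsto_add [OF lim lim] lim evC]) (rule seminorm_triangle [OF _ that])
    show "u (x * y) \<le> u x * u y" if "x \<in> B" "y \<in> B" for x y
      by (rule tendsto_le [OF F tendsto_mult [OF lim lim] lim evC]) (rule seminorm_mult_le [OF _ that])
    show "u (x * x) \<le> u (x * x + y * y)" if "x \<in> B" "y \<in> B" for x y
      by (rule tendsto_le [OF F lim lim evC]) (rule seminorm_square_le_add [OF _ that])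
  qed
  then show ?thesis
    unfolding u_def .
qed

lemma exists_minimal_square_seminorm:
  assumes "b \<in> B"
  obtains q where "square_seminorm q" "q b = norm b"
    "\<And>p. square_seminorm p \<Longrightarrow> p b = norm b \<Longrightarrow> p \<le> q \<Longrightarrow> p = q"
proof -
  define S where "S = {p. square_seminorm p \<and> p b = norm b}"
  define n where "n = (\<lambda>x. if x \<in> B then norm x else 0)"
  have "\<exists>m\<in>S. \<forall>p\<in>S. m \<ge> p \<longrightarrow> p = m"
  proof (rule predicate_Zorn)
    show "partial_order_on S (relation_of (\<ge>) S)"
      by (rule partial_order_on_relation_ofI) auto
    fix C
    assume "C \<in> Chains (relation_of (\<ge>) S)"
    then have chain: "p \<in> S \<and> (p \<le> q \<or> q \<le> p)" if "p \<in> C" "q \<in> C" for p q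
      using that by (auto simp: Chains_def relation_of_def)
    then have CS: "C \<subseteq> S"
      by blast
    show "\<exists>u\<in>S. \<forall>p\<in>C. p \<ge> u"
    proof (cases "C = {}")
      case True
      moreover have "n \<in> S"
        using square_seminorm_norm assms by (simp add: S_def n_def)
      ultimately show ?thesis
        by blast
    next
      case False
      define u where "u x = (INF p\<in>C. p x)" for x
      have "square_seminorm u"
        unfolding u_def using CS False chain
        by (intro square_seminorm_chain_Inf) (auto simp: S_def)
      moreover have "u b = norm b"
        using CS False cINF_const [OF False, of "norm b"]
        by (simp add: u_def S_def subset_eq cong: image_cong_simp)
      moreover have "u x \<le> p x" if "p \<in> C" for p x
        unfolding u_def using CS that
        by (intro cINF_lower bdd_belowI [of _ 0]) (auto simp: S_def seminorm_nonneg)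
      ultimately show ?thesis
        by (auto simp: S_def le_fun_def)
    qed
  qed
  with that show thesis
    unfolding S_def by blast
qed

text \<open>
  Minimality is used twice.  Localising the minimal \<open>q\<close> at \<open>b\<close> itself shows \<open>q x \<le> q (b x)\<close>.  This
  guarantees that localising at any other \<open>c\<close> preserves the value at \<open>b\<close>, so that minimality applies
  again.
\<close>

lemma exists_multiplicative_square_seminorm:
  assumes b: "b \<in> B" "norm b = 1"
  obtains q where "square_seminorm q" "q b = 1"
    "\<And>x y. x \<in> B \<Longrightarrow> y \<in> B \<Longrightarrow> q (x * y) = q x * q y"
proof -
  obtain q where q: "square_seminorm q" "q b = 1"
    and min: "\<And>p. square_seminorm p \<Longrightarrow> p b = 1 \<Longrightarrow> p \<le> q \<Longrightarrow> p = q"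
    using exists_minimal_square_seminorm [OF b(1)] b(2) by metis
  have local: "q x * q c \<le> q (x * c)"
    if c: "c \<in> B" "0 < q c" and x: "x \<in> B"
      and ge: "\<And>k. q (square_iterate c k) \<le> q (b * square_iterate c k)" for x c
  proof -
    have "localised q c b \<le> 1"
      using localised_le [OF q(1) c, of b] q(2) by simp
    moreover have "1 \<le> localised q c b"
      by (rule localised_ge [OF q(1) c b(1)]) (simp add: ge)
    ultimately have "localised q c = q"
      by (intro min square_seminorm_localised q(1) c)
        (auto simp: le_fun_def localised_le [OF q(1) c])
    then show ?thesis
      using localised_le_quotient [OF q(1) c x, of 0] c(2) by (simp add: divide_simps)
  qed
  have iter: "q (square_iterate b k) = 1" for k
    by (induction k) (simp_all add: q b seminorm_square square_iterate_closed)
  \<comment> \<open>Multiplying by \<open>b\<^bsup>2^k\<^esup>\<close> is multiplying by \<open>b\<close> and then by further factors of seminorm \<open>1\<close>.\<close>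
  have shrink: "q (z * square_iterate b k) \<le> q (b * z)" if z: "z \<in> B" for z k
  proof (induction k)
    case 0
    show ?case
      using commute [OF z b(1)] by simp
  next
    case (Suc k)
    let ?c = "square_iterate b k"
    have "q (z * ?c * ?c) \<le> q (z * ?c) * q ?c"
      by (intro seminorm_mult_le q mult_closed z square_iterate_closed b)
    with Suc show ?case
      by (simp add: iter mult.assoc)
  qed
  have b_ge: "q x \<le> q (b * x)" if x: "x \<in> B" for x
  proof -
    have "q (square_iterate b k) \<le> q (b * square_iterate b k)" for k
      using shrink [OF square_iterate_closed [OF b(1)], of k k] iter [of "Suc k"] iter [of k] by simp
    then have "q x * q b \<le> q (x * b)"
      using local [OF b(1) _ x] q(2) by simp
    then show ?thesis
      by (simp add: q(2) commute [OF x b(1)])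
  qed
  have "q (x * y) = q x * q y" if x: "x \<in> B" and y: "y \<in> B" for x y
  proof (rule antisym)
    show "q (x * y) \<le> q x * q y"
      by (rule seminorm_mult_le [OF q(1) x y])
    show "q x * q y \<le> q (x * y)"
    proof (cases "q y = 0")
      case False
      then have "0 < q y"
        using seminorm_nonneg [OF q(1), of y] by simp
      then show ?thesis
        using local [OF y _ x] b_ge square_iterate_closed [OF y] by blast
    qed (simp add: seminorm_nonneg [OF q(1)])
  qed
  with q show thesis
    by (rule that)
qed

section \<open>From multiplicative seminorms to characters\<close>

definition character :: "('a \<Rightarrow> real) \<Rightarrow> bool" where
  "character \<phi> \<longleftrightarrow>
     (\<forall>x\<in>B. \<forall>y\<in>B. \<phi> (x + y) = \<phi> x + \<phi> y \<and> \<phi> (x * y) = \<phi> x * \<phi> y) \<and>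
     (\<forall>r. \<forall>x\<in>B. \<phi> (r *\<^sub>R x) = r * \<phi> x) \<and>
     (\<forall>x\<in>B. \<bar>\<phi> x\<bar> \<le> norm x)"

text \<open>
  For \<open>q x = q y = 1\<close> write \<open>(x\<^sup>2 + y\<^sup>2)\<^sup>2 = (2xy)\<^sup>2 + (x\<^sup>2 - y\<^sup>2)\<^sup>2\<close>; monotonicity on sums of squares
  gives \<open>q (x\<^sup>2 + y\<^sup>2) \<ge> q (2xy) = 2\<close>.  Elements of different size are first scaled to this case, and
  the excess is removed by the triangle inequality.
\<close>

lemma seminorm_add_squares:
  assumes q: "square_seminorm q"
    and mult: "\<And>x y. x \<in> B \<Longrightarrow> y \<in> B \<Longrightarrow> q (x * y) = q x * q y"
    and x: "x \<in> B" and y: "y \<in> B"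
  shows "q (x * x + y * y) = q (x * x) + q (y * y)"
proof -
  have equal: "q (x * x + y * y) = 2" if x: "x \<in> B" "q x = 1" and y: "y \<in> B" "q y = 1" for x y
  proof -
    let ?s = "x * x - y * y" and ?t = "2 *\<^sub>R (x * y)" and ?u = "x * x + y * y"
    note cl = mult_closed add_closed diff_closed scale_closed
    have "?u * ?u = ?t * ?t + ?s * ?s"
      using commute [OF x(1) y(1)]
      by (simp add: algebra_simps scaleR_2) (metis mult.assoc)
    moreover have "q (?t * ?t) \<le> q (?t * ?t + ?s * ?s)"
      by (intro seminorm_square_le_add q cl x y)
    ultimately have "q (?t * ?t) \<le> q (?u * ?u)"
      by (simp only:)
    moreover have "q (?t * ?t) = q ?t * q ?t" "q (?u * ?u) = q ?u * q ?u"
      by (intro mult cl x y)+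
    ultimately have "q ?t * q ?t \<le> q ?u * q ?u"
      by (simp only:)
    then have "q ?t \<le> q ?u"
      using seminorm_nonneg [OF q] by (simp flip: abs_le_square_iff power2_eq_square)
    moreover have "q ?t = 2"
      by (simp add: seminorm_scaleR [OF q] mult cl x y)
    moreover have "q ?u \<le> 2"
      using seminorm_triangle [OF q, of "x * x" "y * y"] by (simp add: mult cl x y)
    ultimately show ?thesis
      by simp
  qed
  have ordered: "q (x * x + y * y) = q (x * x) + q (y * y)"
    if x: "x \<in> B" and y: "y \<in> B" and le: "q y \<le> q x" for x y
  proof (cases "q y = 0")
    case True
    have "q (x * x) \<le> q (x * x + y * y)" "q (x * x + y * y) \<le> q (x * x) + q (y * y)"
      by (intro seminorm_square_le_add seminorm_triangle q mult_closed x y)+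
    then show ?thesis
      using True by (simp add: mult x y)
  next
    case False
    then have pos: "0 < q y" "0 < q x"
      using seminorm_nonneg [OF q, of y] le by auto
    \<comment> \<open>The multiple of \<open>y\<^sup>2\<close> by which the scaled sum exceeds \<open>x\<^sup>2 + y\<^sup>2\<close>.\<close>
    define d where "d = (q x / q y)\<^sup>2 - 1"
    have d: "0 \<le> d"
      using le pos by (simp add: d_def divide_simps)
    let ?x = "(1 / q x) *\<^sub>R x" and ?y = "(1 / q y) *\<^sub>R y"
    have "q (?x * ?x + ?y * ?y) = 2"
      by (rule equal) (use pos in \<open>simp_all add: x y scale_closed seminorm_scaleR [OF q]\<close>)
    then have "(q x)\<^sup>2 * q (?x * ?x + ?y * ?y) = 2 * (q x)\<^sup>2"
      by simp
    moreover have "(q x)\<^sup>2 *\<^sub>R (?x * ?x + ?y * ?y) = (x * x + y * y) + d *\<^sub>R (y * y)"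
      using pos by (simp add: d_def algebra_simps power2_eq_square)
    moreover have "(q x)\<^sup>2 * q (?x * ?x + ?y * ?y) = q ((q x)\<^sup>2 *\<^sub>R (?x * ?x + ?y * ?y))"
      by (subst seminorm_scaleR [OF q]) (simp_all add: x y scale_closed mult_closed add_closed)
    ultimately have "2 * (q x)\<^sup>2 = q ((x * x + y * y) + d *\<^sub>R (y * y))"
      by (simp only:)
    also have "\<dots> \<le> q (x * x + y * y) + q (d *\<^sub>R (y * y))"
      by (intro seminorm_triangle q add_closed scale_closed mult_closed x y)
    also have "q (d *\<^sub>R (y * y)) = (q x)\<^sup>2 - (q y)\<^sup>2"
      using pos d
      by (simp add: seminorm_scaleR [OF q] mult_closed y mult)
        (simp add: d_def field_simps power2_eq_square)
    finally have "(q x)\<^sup>2 + (q y)\<^sup>2 \<le> q (x * x + y * y)"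
      by simp
    moreover have "q (x * x + y * y) \<le> q (x * x) + q (y * y)"
      by (intro seminorm_triangle q mult_closed x y)
    ultimately show ?thesis
      by (simp add: mult x y power2_eq_square)
  qed
  show ?thesis
    using ordered [OF x y] ordered [OF y x] by (cases "q x \<le> q y") (simp_all add: add.commute)
qed

text \<open>
  With \<open>s = x\<^sup>2\<close> and \<open>t = y\<^sup>2\<close>, additivity on squares turns \<open>(s + t)\<^sup>2 + (s - t)\<^sup>2 = 2 (s\<^sup>2 + t\<^sup>2)\<close> into
  an equation of numbers in which \<open>q (s + t) = q s + q t = 2 q s\<close> already accounts for the entire
  right-hand side.
\<close>

lemma seminorm_diff_squares:
  assumes q: "square_seminorm q"
    and mult: "\<And>x y. x \<in> B \<Longrightarrow> y \<in> B \<Longrightarrow> q (x * y) = q x * q y"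
    and x: "x \<in> B" and y: "y \<in> B" and eq: "q x = q y"
  shows "q (x * x - y * y) = 0"
proof -
  note cl = mult_closed add_closed diff_closed scale_closed
  have add: "q (u * u + v * v) = q (u * u) + q (v * v)" if "u \<in> B" "v \<in> B" for u v
    by (rule seminorm_add_squares [OF q mult that])
  let ?s = "x * x" and ?t = "y * y"
  have "(?s + ?t) * (?s + ?t) + (?s - ?t) * (?s - ?t) = 2 *\<^sub>R (?s * ?s + ?t * ?t)"
    by (simp add: algebra_simps scaleR_2)
  then have "q (?s + ?t) * q (?s + ?t) + q (?s - ?t) * q (?s - ?t) = 2 * (q ?s * q ?s + q ?t * q ?t)"
    using add [of "?s + ?t" "?s - ?t"] add [of ?s ?t]
    by (simp add: seminorm_scaleR [OF q] mult cl x y)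
  then show ?thesis
    unfolding add [OF x y] by (simp add: mult x y eq algebra_simps)
qed

text \<open>
  For every \<open>x\<close> the factorisation \<open>x\<^sup>2 - y\<^sup>2 = (x - y) (x + y)\<close> with \<open>y = q x \<cdot> e\<close> shows that \<open>x\<close> is a
  multiple of \<open>e\<close> modulo the null space of \<open>q\<close>; the character reads off that multiple.  Taking the
  square \<open>e = b\<^sup>2\<close> as reference element ensures that \<open>e\<^sup>2 = e\<close> modulo the null space: the alternative
  \<open>e\<^sup>2 = - e\<close> contradicts \<open>q (e\<^sup>2 + b\<^sup>2) = 2\<close>.
\<close>

lemma multiplicative_seminorm_character:
  assumes q: "square_seminorm q" and b: "b \<in> B" "q b = 1"
    and mult: "\<And>x y. x \<in> B \<Longrightarrow> y \<in> B \<Longrightarrow> q (x * y) = q x * q y"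
  obtains \<phi> where "character \<phi>" "\<And>x. x \<in> B \<Longrightarrow> \<bar>\<phi> x\<bar> = q x"
proof -
  note cl = mult_closed add_closed diff_closed scale_closed
  define e where "e = b * b"
  have e: "e \<in> B" "q e = 1"
    by (simp_all add: e_def cl b mult)
  have null_add: "q (x + y) = 0" if "x \<in> B" "y \<in> B" "q x = 0" "q y = 0" for x y
    using seminorm_triangle [OF q that(1,2)] seminorm_nonneg [OF q, of "x + y"] that(3,4) by simp
  have null_scale: "q (r *\<^sub>R x) = 0" if "x \<in> B" "q x = 0" for r x
    using seminorm_scaleR [OF q that(1)] that(2) by simp
  have ex: "\<exists>r. q (x - r *\<^sub>R e) = 0" if x: "x \<in> B" for x
  proof -
    let ?y = "q x *\<^sub>R e"
    have "q (x * x - ?y * ?y) = 0"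
      by (rule seminorm_diff_squares [OF q mult])
        (simp_all add: x e cl seminorm_scaleR [OF q] seminorm_nonneg [OF q])
    moreover have "x * x - ?y * ?y = (x - ?y) * (x + ?y)"
      using commute [OF x e(1)] by (simp add: algebra_simps)
    ultimately have "q (x - ?y) = 0 \<or> q (x + ?y) = 0"
      by (simp add: mult cl x e)
    moreover have "x + ?y = x - (- q x) *\<^sub>R e"
      by simp
    ultimately show ?thesis
      by metis
  qed
  have unique: "r = s" if x: "x \<in> B" and "q (x - r *\<^sub>R e) = 0" "q (x - s *\<^sub>R e) = 0" for x r s
  proof -
    have "q ((x - r *\<^sub>R e) + (-1) *\<^sub>R (x - s *\<^sub>R e)) = 0"
      by (intro null_add null_scale that cl e)
    moreover have "(x - r *\<^sub>R e) + (-1) *\<^sub>R (x - s *\<^sub>R e) = (s - r) *\<^sub>R e"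
      by (simp add: algebra_simps)
    ultimately show ?thesis
      using seminorm_scaleR [OF q e(1), of "s - r"] e(2) by simp
  qed
  define \<phi> where "\<phi> x = (THE r. q (x - r *\<^sub>R e) = 0)" for x
  have \<phi>I: "\<phi> x = r" if "x \<in> B" "q (x - r *\<^sub>R e) = 0" for x r
    unfolding \<phi>_def using that unique by blast
  have \<phi>: "q (x - \<phi> x *\<^sub>R e) = 0" if "x \<in> B" for x
    using ex [OF that] \<phi>I [OF that] by metis
  have abs: "\<bar>\<phi> x\<bar> = q x" if x: "x \<in> B" for x
  proof -
    have "q (\<phi> x *\<^sub>R e) = \<bar>\<phi> x\<bar>"
      by (simp add: seminorm_scaleR [OF q] e)
    moreover have "q x \<le> q (x - \<phi> x *\<^sub>R e) + q (\<phi> x *\<^sub>R e)"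
      using seminorm_triangle [OF q, of "x - \<phi> x *\<^sub>R e" "\<phi> x *\<^sub>R e"] by (simp add: x e cl)
    moreover have "q (\<phi> x *\<^sub>R e) \<le> q ((-1) *\<^sub>R (x - \<phi> x *\<^sub>R e)) + q x"
      using seminorm_triangle [OF q, of "(-1) *\<^sub>R (x - \<phi> x *\<^sub>R e)" x] by (simp add: x e cl)
    ultimately show ?thesis
      using \<phi> [OF x] null_scale [of "x - \<phi> x *\<^sub>R e" "-1"] by (simp add: x e cl)
  qed
  have "character \<phi>"
    unfolding character_def
  proof (intro conjI ballI allI)
    fix x y
    assume x: "x \<in> B" and y: "y \<in> B"
    have "q ((x - \<phi> x *\<^sub>R e) + (y - \<phi> y *\<^sub>R e)) = 0"
      by (intro null_add \<phi> x y cl e)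
    then show "\<phi> (x + y) = \<phi> x + \<phi> y"
      by (intro \<phi>I) (simp_all add: x y cl algebra_simps)
    have "q (e * e + b * b) = 2"
      using seminorm_add_squares [OF q mult e(1) b(1)] by (simp add: mult e b)
    moreover have "q ((e - e * e) * (e + e * e)) = 0"
      using seminorm_diff_squares [OF q mult, of e "e * e"]
      by (simp add: e cl mult algebra_simps)
    ultimately have "q (e - e * e) = 0"
      by (simp add: mult e cl) (simp add: e_def add.commute)
    have "q ((x - \<phi> x *\<^sub>R e) * y + \<phi> x *\<^sub>R (e * (y - \<phi> y *\<^sub>R e)) + (- \<phi> x * \<phi> y) *\<^sub>R (e - e * e)) = 0"
      by (intro null_add null_scale cl e x y) (simp_all add: mult x y e cl \<phi> \<open>q (e - e * e) = 0\<close>)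
    then show "\<phi> (x * y) = \<phi> x * \<phi> y"
      by (intro \<phi>I) (simp_all add: x y cl algebra_simps)
  next
    fix r x
    assume x: "x \<in> B"
    have "q (r *\<^sub>R (x - \<phi> x *\<^sub>R e)) = 0"
      by (intro null_scale \<phi> x cl e)
    then show "\<phi> (r *\<^sub>R x) = r * \<phi> x"
      by (intro \<phi>I) (simp_all add: x cl algebra_simps)
  next
    show "\<bar>\<phi> x\<bar> \<le> norm x" if "x \<in> B" for x
      using abs [OF that] seminorm_le_norm [OF q, of x] by simp
  qed
  then show thesis
    using abs by (rule that)
qed

theorem exists_norming_character:
  assumes x: "x \<in> B"
  obtains \<phi> where "character \<phi>" "\<bar>\<phi> x\<bar> = norm x"
proof (cases "x = 0")
  case True
  have "character (\<lambda>_. 0)"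
    by (simp add: character_def)
  with True that show thesis
    by force
next
  case False
  let ?b = "(1 / norm x) *\<^sub>R x"
  have b: "?b \<in> B" "norm ?b = 1"
    using False by (simp_all add: x scale_closed)
  obtain q where q: "square_seminorm q" "q ?b = 1"
    "\<And>x y. x \<in> B \<Longrightarrow> y \<in> B \<Longrightarrow> q (x * y) = q x * q y"
    using exists_multiplicative_square_seminorm [OF b] by blast
  obtain \<phi> where \<phi>: "character \<phi>" "\<And>x. x \<in> B \<Longrightarrow> \<bar>\<phi> x\<bar> = q x"
    using multiplicative_seminorm_character [OF q(1) b(1) q(2,3)] by blast
  have "\<bar>\<phi> x\<bar> = norm x"
    using \<phi>(2) [OF x] q(2) False by (simp add: seminorm_scaleR [OF q(1) x] field_simps)
  with \<phi>(1) show thesis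
    by (rule that)
qed

end

section \<open>Quaternions and the centre of a bimodule\<close>

abbreviation "qI \<equiv> Quat 0 1 0 0"
abbreviation "qJ \<equiv> Quat 0 0 1 0"
abbreviation "qK \<equiv> Quat 0 0 0 1"

lemma of_real_quat: "(of_real r :: quat) = Quat r 0 0 0"
  by (simp add: of_real_def scaleR_quat_def one_quat_def)

lemma quat_units_mult:
  "qI * qI = - 1" "qJ * qJ = - 1" "qK * qK = - 1"
  "qI * qJ = qK" "qJ * qK = qI" "qK * qI = qJ"
  "qJ * qI = - qK" "qK * qJ = - qI" "qI * qK = - qJ"
  by (simp_all add: times_quat_def uminus_quat_def one_quat_def)

lemma norm_quat_units: "norm qI = 1" "norm qJ = 1" "norm qK = 1"
  by (simp_all add: norm_quat_def)

lemma quat_decompose: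
  "q = of_real (qRe q) + of_real (qIm1 q) * qI + of_real (qIm2 q) * qJ + of_real (qIm3 q) * qK"
  by (simp add: of_real_quat quat_eq_iff times_quat_def plus_quat_def)

lemma qcnj_simps [simp]:
  "qcnj (p + q) = qcnj p + qcnj q" "qcnj (p * q) = qcnj q * qcnj p" "qcnj (qcnj p) = p"
  "qcnj 0 = 0" "qcnj (of_real r) = of_real r"
  "qcnj qI = - qI" "qcnj qJ = - qJ" "qcnj qK = - qK"
  by (simp_all add: qcnj_def quat_eq_iff times_quat_def plus_quat_def uminus_quat_def zero_quat_def
      of_real_quat)

lemma qcnj_mult_self:
  "qcnj q * q = of_real ((norm q)\<^sup>2)" "q * qcnj q = of_real ((norm q)\<^sup>2)"
  by (simp_all add: qcnj_def quat_eq_iff times_quat_def of_real_quat norm_quat_def power2_eq_square)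

lemma qcnj_fixed_iff: "qcnj q = q \<longleftrightarrow> q = of_real (qRe q)"
  by (auto simp: qcnj_def quat_eq_iff of_real_quat)

lemma of_real_commute_quat: "of_real r * q = q * (of_real r :: quat)"
  by (simp add: of_real_quat quat_eq_iff times_quat_def)

context quat_vector_space
begin

lemma lscale_linear: "linear (lscale \<alpha>)"
proof
  fix r x
  have "lscale \<alpha> (rscale x (of_real r)) = rscale (lscale \<alpha> x) (of_real r)"
    by (rule lscale_rscale)
  then show "lscale \<alpha> (r *\<^sub>R x) = r *\<^sub>R lscale \<alpha> x"
    by (simp add: rscale_of_real)
qed (rule lscale_add_right)

lemma rscale_linear: "linear (\<lambda>x. rscale x \<alpha>)"
proof
  fix r x
  have "lscale (of_real r) (rscale x \<alpha>) = rscale (lscale (of_real r) x) \<alpha>"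
    by (rule lscale_rscale)
  then show "rscale (r *\<^sub>R x) \<alpha> = r *\<^sub>R rscale x \<alpha>"
    by (simp add: lscale_of_real)
qed (rule rscale_add_left)

lemma lscale_real_multiple: "lscale (of_real r * \<alpha>) x = r *\<^sub>R lscale \<alpha> x"
  by (simp add: lscale_of_real flip: lscale_lscale)

lemma rscale_real_multiple: "rscale x (of_real r * \<alpha>) = r *\<^sub>R rscale x \<alpha>"
  by (simp add: rscale_of_real linear_scale [OF rscale_linear] flip: rscale_rscale)

lemma scale_one: "lscale 1 x = x" "rscale x 1 = x"
  using lscale_of_real [of 1] rscale_of_real [of _ 1] by simp_all

lemma scale_minus_left: "lscale (- \<alpha>) x = - lscale \<alpha> x" "rscale x (- \<alpha>) = - rscale x \<alpha>"
  using lscale_real_multiple [of "-1"] rscale_real_multiple [of _ "-1"] by simp_all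

lemma lscale_diff_left: "lscale (\<alpha> - \<beta>) x = lscale \<alpha> x - lscale \<beta> x"
  using lscale_add_left [of \<alpha> "- \<beta>" x] by (simp add: scale_minus_left)

lemmas scale_simps =
  lscale_lscale rscale_rscale lscale_rscale scale_one scale_minus_left
  lscale_add_right rscale_add_left
  linear_scale [OF lscale_linear] linear_scale [OF rscale_linear]
  linear_diff [OF lscale_linear] linear_diff [OF rscale_linear]
  linear_neg [OF lscale_linear] linear_neg [OF rscale_linear]
  linear_0 [OF lscale_linear] linear_0 [OF rscale_linear]

lemma lscale_cancel:
  assumes "lscale \<gamma> x = lscale \<gamma> y" "\<gamma> \<noteq> 0"
  shows "x = y"
proof -
  have "lscale (inverse \<gamma>) (lscale \<gamma> x) = lscale (inverse \<gamma>) (lscale \<gamma> y)"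
    by (simp only: assms(1))
  with assms(2) show ?thesis
    by (simp add: lscale_lscale scale_one)
qed

definition centre :: "'a set" where
  "centre = {x. \<forall>\<gamma>. lscale \<gamma> x = rscale x \<gamma>}"

lemma centreD: "x \<in> centre \<Longrightarrow> rscale x \<gamma> = lscale \<gamma> x"
  by (simp add: centre_def)

lemma centreI:
  assumes "lscale qI x = rscale x qI" "lscale qJ x = rscale x qJ" "lscale qK x = rscale x qK"
  shows "x \<in> centre"
proof -
  have "lscale \<gamma> x = rscale x \<gamma>" for \<gamma>
    by (subst (1 2) quat_decompose)
      (simp only: lscale_add_left rscale_add_right lscale_real_multiple rscale_real_multiple assms
        lscale_of_real rscale_of_real)
  then show ?thesis
    by (simp add: centre_def)
qed

lemma subspace_centre: "subspace centre"
  by (rule subspaceI) (auto simp: centre_def scale_simps)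

definition central_part :: "'a \<Rightarrow> 'a" where
  "central_part x =
     (1/4) *\<^sub>R (x - rscale (lscale qI x) qI - rscale (lscale qJ x) qJ - rscale (lscale qK x) qK)"

lemma central_part_in_centre: "central_part x \<in> centre"
  by (rule centreI) (simp_all add: central_part_def scale_simps quat_units_mult algebra_simps)

lemma linear_central_part: "linear central_part"
  by (rule linearI) (simp_all add: central_part_def scale_simps algebra_simps)

text \<open>
  Left multiplication by \<open>- i\<close>, \<open>- j\<close>, \<open>- k\<close> moves the respective component into the centre, as
  \<open>(- i) i = 1\<close>.
\<close>

lemma central_decomposition:
  "x = central_part x + lscale qI (central_part (lscale (- qI) x)) +
     lscale qJ (central_part (lscale (- qJ) x)) + lscale qK (central_part (lscale (- qK) x))"
proof -
  have "4 *\<^sub>R x = 4 *\<^sub>R (central_part x + lscale qI (central_part (lscale (- qI) x)) +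
     lscale qJ (central_part (lscale (- qJ) x)) + lscale qK (central_part (lscale (- qK) x)))"
    using scaleR_left_distrib [of 2 2 x]
    by (simp add: central_part_def scale_simps quat_units_mult algebra_simps scaleR_2)
  then show ?thesis
    by simp
qed

text \<open>
  For central \<open>x\<close> the averaging acts on the factor \<open>\<gamma>\<close> of \<open>\<gamma> x\<close> alone, and on quaternions it
  extracts the real part.
\<close>

lemma central_part_lscale:
  assumes "x \<in> centre"
  shows "central_part (lscale \<gamma> x) = qRe \<gamma> *\<^sub>R x"
proof -
  have "rscale (lscale \<alpha> x) \<beta> = lscale (\<alpha> * \<beta>) x" for \<alpha> \<beta>
    using lscale_rscale [of \<alpha> x \<beta>] by (simp add: centreD [OF assms] lscale_lscale)
  then have "central_part (lscale \<gamma> x) =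
      (1/4) *\<^sub>R lscale (\<gamma> - qI * \<gamma> * qI - qJ * \<gamma> * qJ - qK * \<gamma> * qK) x"
    by (simp only: central_part_def lscale_lscale lscale_diff_left)
  also have "\<gamma> - qI * \<gamma> * qI - qJ * \<gamma> * qJ - qK * \<gamma> * qK = of_real (4 * qRe \<gamma>)"
    unfolding of_real_quat by (simp add: quat_eq_iff times_quat_def minus_quat_def)
  finally show ?thesis
    by (simp only: lscale_of_real) simp
qed

text \<open>
  By the decomposition, additive statements about the whole space need only be verified on
  multiples of central elements.
\<close>

lemma central_induct [case_names lscale add]:
  assumes "\<And>\<gamma> x. x \<in> centre \<Longrightarrow> Q (lscale \<gamma> x)" and "\<And>x y. Q x \<Longrightarrow> Q y \<Longrightarrow> Q (x + y)"
  shows "Q x"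
  by (subst central_decomposition)
    (use assms(1) [of _ 1] in \<open>auto intro!: assms central_part_in_centre simp: scale_one\<close>)

end

context quat_normed_space
begin

lemma norm_central_part_le: "norm (central_part x) \<le> norm x"
proof -
  have unit: "norm (rscale (lscale q x) q) \<le> norm x" if "norm q = 1" for q
    using norm_scale_le [of q x q] that by simp
  let ?f = "\<lambda>q. rscale (lscale q x) q"
  have "norm (x - ?f qI - ?f qJ - ?f qK) \<le> norm x + norm (?f qI) + norm (?f qJ) + norm (?f qK)"
    by (intro order_trans [OF norm_triangle_ineq4] add_mono order_refl)
  with unit [OF norm_quat_units(1)] unit [OF norm_quat_units(2)] unit [OF norm_quat_units(3)]
  show ?thesis
    by (simp add: central_part_def)
qed

end

context quat_algebra
begin

lemma centre_mult_lscale: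
  assumes "x \<in> centre"
  shows "x * lscale \<gamma> y = lscale \<gamma> (x * y)"
  by (simp add: centreD [OF assms] lscale_mult flip: rscale_mult_lscale)

lemma lscale_mult_lscale:
  assumes "x \<in> centre"
  shows "lscale \<alpha> x * lscale \<beta> y = lscale (\<alpha> * \<beta>) (x * y)"
  by (simp add: lscale_mult centre_mult_lscale [OF assms] lscale_lscale)

lemma centre_mult:
  assumes "x \<in> centre" "y \<in> centre"
  shows "x * y \<in> centre"
proof -
  have "lscale \<gamma> (x * y) = rscale (x * y) \<gamma>" for \<gamma>
    by (simp add: mult_rscale centreD [OF assms(2)] centre_mult_lscale [OF assms(1)])
  then show ?thesis
    by (simp add: centre_def)
qed

end

context quat_involution
begin

lemma star_linear: "linear star"
  by (rule linearI) (simp_all add: star_add star_scaleR)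

lemma star_centre:
  assumes "x \<in> centre"
  shows "star x \<in> centre"
proof -
  have "lscale \<gamma> (star x) = rscale (star x) \<gamma>" for \<gamma>
    using star_rscale [of x "qcnj \<gamma>"] star_lscale [of "qcnj \<gamma>" x]
    by (simp add: centreD [OF assms])
  then show ?thesis
    by (simp add: centre_def)
qed

lemma star_lscale_centre:
  assumes "x \<in> centre"
  shows "star (lscale \<gamma> x) = lscale (qcnj \<gamma>) (star x)"
  by (simp add: star_lscale centreD [OF star_centre [OF assms]])

end

section \<open>The centre of an algebra of normal elements\<close>

locale normal_quat_Bstar_algebra = quat_Bstar_algebra +
  assumes normal: "star a * a = a * star a"
begin

lemma normal_polarised: "star a * b + star b * a = a * star b + b * star a"
proof -
  have "star (a + b) * (a + b) = (a + b) * star (a + b)"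
    by (rule normal)
  then show ?thesis
    by (simp add: star_add algebra_simps normal)
qed

text \<open>
  Replacing \<open>y\<close> by \<open>i y\<close> in the polarised identity changes, up to a common factor \<open>i\<close>, the sign of every
  term containing \<open>y\<^sup>*\<close>, because \<open>i\<^sup>* = - i\<close>; adding the two identities isolates \<open>x\<^sup>* y = y x\<^sup>*\<close>.  The
  pair \<open>(i x, j y)\<close> contributes a further equation, in which \<open>i j = - j i\<close> reverses signs, and it
  forces \<open>x\<^sup>* y = y\<^sup>* x\<close>.
\<close>

lemma star_mult_centre:
  assumes x: "x \<in> centre" and y: "y \<in> centre"
  shows "star x * y = y * star x" "star x * y = star y * x"
proof -
  note sc = star_centre [OF x] star_centre [OF y]
  have 1: "star x * y + star y * x = x * star y + y * star x"
    by (rule normal_polarised)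
  have "lscale qI (star x * y - star y * x) = lscale qI (y * star x - x * star y)"
    using normal_polarised [of x "lscale qI y"]
    by (simp add: star_lscale_centre y x lscale_mult centre_mult_lscale sc scale_simps algebra_simps)
  then have 2: "star x * y - star y * x = y * star x - x * star y"
    by (rule lscale_cancel) (simp add: zero_quat_def)
  have "2 *\<^sub>R (star x * y) = 2 *\<^sub>R (y * star x)"
    using arg_cong2 [OF 1 2, of "(+)"] by (simp add: scaleR_2 algebra_simps)
  then show com: "star x * y = y * star x"
    by simp
  have com': "star y * x = x * star y"
    using 1 com by simp
  have "lscale qK (star y * x - star x * y) = lscale qK (y * star x - x * star y)"
    using normal_polarised [of "lscale qI x" "lscale qJ y"]
    by (simp add: star_lscale_centre y x lscale_mult_lscale sc scale_simps quat_units_mult algebra_simps)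
  then have "star y * x - star x * y = y * star x - x * star y"
    by (rule lscale_cancel) (simp add: zero_quat_def)
  then have "2 *\<^sub>R (star x * y) = 2 *\<^sub>R (star y * x)"
    by (simp add: com com' scaleR_2 algebra_simps)
  then show "star x * y = star y * x"
    by simp
qed

text \<open>
  For the skew element \<open>n = x\<^sup>* - x\<close> and the self-adjoint element \<open>n\<^sup>2\<close> the identity \<open>x\<^sup>* y = y\<^sup>* x\<close> reads
  \<open>- n\<^sup>3 = n\<^sup>3\<close>; the \<open>B\<^sup>*\<close>-identity, applied to \<open>n\<^sup>2\<close> and then to \<open>n\<close>, turns \<open>n\<^sup>3 = 0\<close> into \<open>n = 0\<close>.
\<close>

lemma star_centre_id:
  assumes x: "x \<in> centre"
  shows "star x = x"
proof -
  have nilpotent: "a = 0" if "star a = a" "a * a = 0" for a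
    using norm_star_mult_self [of a] that by simp
  define n where "n = star x - x"
  have n: "n \<in> centre"
    using subspace_diff [OF subspace_centre star_centre [OF x] x] by (simp add: n_def)
  have star_n: "star n = - n"
    by (simp add: n_def linear_diff [OF star_linear] star_star)
  have "star n * (n * n) = star (n * n) * n"
    by (rule star_mult_centre [OF n centre_mult [OF n n]])
  then have "2 *\<^sub>R (n * (n * n)) = 0"
    by (simp add: star_n star_mult scaleR_2 mult.assoc neg_eq_iff_add_eq_0)
  then have "n * n * n = 0"
    by (simp add: mult.assoc)
  have "n * n = 0"
    by (rule nilpotent) (use \<open>n * n * n = 0\<close> in \<open>simp_all add: star_mult star_n flip: mult.assoc\<close>)
  then have "norm n = 0"
    using norm_star_mult_self [of n] by (simp add: star_n)
  then show ?thesis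
    by (simp add: n_def)
qed

text \<open>
  It is enough that \<open>a + a\<^sup>*\<close> is always central, and for \<open>a = \<gamma> x\<close> with \<open>x\<close> central this sum is
  \<open>(\<gamma> + \<gamma>\<^sup>*) x = 2 Re \<gamma> x\<close>.
\<close>

lemma self_adjoint_in_centre:
  assumes "star h = h"
  shows "h \<in> centre"
proof -
  have "2 *\<^sub>R h = h + star h"
    by (simp add: scaleR_2 assms)
  moreover have "x + star x \<in> centre" for x
  proof (induction x rule: central_induct)
    case (lscale \<gamma> x)
    have "\<gamma> + qcnj \<gamma> = of_real (2 * qRe \<gamma>)"
      unfolding of_real_quat by (simp add: qcnj_def plus_quat_def)
    then have "lscale \<gamma> x + star (lscale \<gamma> x) = lscale (of_real (2 * qRe \<gamma>)) x"
      by (simp only: star_lscale_centre star_centre_id lscale flip: lscale_add_left)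
    then show ?case
      by (simp only: lscale_of_real subspace_scale [OF subspace_centre lscale])
  next
    case (add x y)
    then show ?case
      using subspace_add [OF subspace_centre add] by (simp add: star_add algebra_simps)
  qed
  ultimately have "2 *\<^sub>R h \<in> centre"
    by (simp only:)
  from subspace_scale [OF subspace_centre this, of "1/2"] show ?thesis
    by simp
qed

sublocale centre: real_function_algebra centre
proof
  fix x y
  assume x: "x \<in> centre" and y: "y \<in> centre"
  show "x * y \<in> centre"
    by (rule centre_mult [OF x y])
  show com: "x * y = y * x"
    using star_mult_centre(1) [OF x y] by (simp add: star_centre_id x)
  show square: "norm (x * x) = (norm x)\<^sup>2"
    using norm_star_mult_self [of x] by (simp add: star_centre_id x)
  \<comment> \<open>\<open>a = x + i y\<close> has \<open>a\<^sup>* a = x\<^sup>2 + y\<^sup>2\<close> and central part \<open>x\<close>, which is not larger than \<open>a\<close>.\<close>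
  let ?a = "x + lscale qI y"
  have "qRe 1 = 1"
    by (simp add: one_quat_def)
  then have "central_part ?a = x"
    using central_part_lscale [OF x, of 1] central_part_lscale [OF y, of qI]
    by (simp add: linear_add [OF linear_central_part] scale_one)
  then have "(norm x)\<^sup>2 \<le> (norm ?a)\<^sup>2"
    using norm_central_part_le [of ?a] by simp
  also have "\<dots> = norm (star ?a * ?a)"
    by (simp only: norm_star_mult_self)
  also have "star ?a * ?a = x * x + y * y"
    by (simp add: star_add star_lscale_centre star_centre_id x y com algebra_simps lscale_mult
        centre_mult_lscale scale_simps quat_units_mult)
  finally show "norm (x * x) \<le> norm (x * x + y * y)"
    by (simp only: square)
qed (rule subspace_centre)

end

section \<open>The topology of pointwise convergence\<close>

lemma open_evaluation_vimage: "open U \<Longrightarrow> open {h. h a \<in> U}"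
  using open_vimage [OF _ continuous_on_product_coordinates, of U a] by (simp add: vimage_def)

text \<open>
  The Stone--Weierstrass theorem will be applied to a compact set of functions, so function spaces have
  to belong to the class of Hausdorff spaces and to its superclasses.
\<close>

instance "fun" :: (type, t0_space) t0_space
proof
  fix f g :: "'a \<Rightarrow> 'b"
  assume "f \<noteq> g"
  then obtain a where "f a \<noteq> g a"
    by blast
  then obtain U where "open U" "\<not> (f a \<in> U \<longleftrightarrow> g a \<in> U)"
    using t0_space_class.t0_space [OF \<open>f a \<noteq> g a\<close>] by auto
  then show "\<exists>U. open U \<and> \<not> (f \<in> U \<longleftrightarrow> g \<in> U)"
    by (intro exI [of _ "{h. h a \<in> U}"]) (simp add: open_evaluation_vimage)
qed

instance "fun" :: (type, t1_space) t1_space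
proof
  fix f g :: "'a \<Rightarrow> 'b"
  assume "f \<noteq> g"
  then obtain a where "f a \<noteq> g a"
    by blast
  then obtain U where "open U" "f a \<in> U" "g a \<notin> U"
    using t1_space_class.t1_space [OF \<open>f a \<noteq> g a\<close>] by auto
  then show "\<exists>U. open U \<and> f \<in> U \<and> g \<notin> U"
    by (intro exI [of _ "{h. h a \<in> U}"]) (simp add: open_evaluation_vimage)
qed

instance "fun" :: (type, t2_space) t2_space
proof
  fix f g :: "'a \<Rightarrow> 'b"
  assume "f \<noteq> g"
  then obtain a where "f a \<noteq> g a"
    by blast
  then obtain U V where UV: "open U" "open V" "f a \<in> U" "g a \<in> V" "U \<inter> V = {}"
    using hausdorff [OF \<open>f a \<noteq> g a\<close>] by auto
  let ?U = "{h. h a \<in> U}" and ?V = "{h. h a \<in> V}"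
  have "?U \<inter> ?V = {}"
    using UV(5) by auto
  with UV(1-4) show "\<exists>U V. open U \<and> open V \<and> f \<in> U \<and> g \<in> V \<and> U \<inter> V = {}"
    by (intro exI [of _ ?U] exI [of _ ?V]) (simp add: open_evaluation_vimage)
qed

lemma continuous_on_evaluation: "continuous_on S (\<lambda>h. h a :: 'b::topological_space)"
  by (rule continuous_on_subset [OF continuous_on_product_coordinates subset_UNIV])

lemma continuous_on_qcnj [continuous_intros]:
  assumes "continuous_on S f"
  shows "continuous_on S (\<lambda>x. qcnj (f x))"
proof -
  have "linear qcnj"
    by (rule linearI) (simp_all add: qcnj_def plus_quat_def scaleR_quat_def)
  then have "bounded_linear qcnj"
    by (simp add: linear_conv_bounded_linear)
  then show ?thesis
    using assms by (rule bounded_linear.continuous_on)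
qed

lemma continuous_on_quat_components [continuous_intros]:
  assumes "continuous_on S f"
  shows "continuous_on S (\<lambda>x. qRe (f x))" "continuous_on S (\<lambda>x. qIm1 (f x))"
    "continuous_on S (\<lambda>x. qIm2 (f x))" "continuous_on S (\<lambda>x. qIm3 (f x))"
proof -
  have "linear qRe" "linear qIm1" "linear qIm2" "linear qIm3"
    by (rule linearI; simp add: plus_quat_def scaleR_quat_def)+
  then have "bounded_linear qRe" "bounded_linear qIm1" "bounded_linear qIm2" "bounded_linear qIm3"
    by (simp_all add: linear_conv_bounded_linear)
  then show "continuous_on S (\<lambda>x. qRe (f x))" "continuous_on S (\<lambda>x. qIm1 (f x))"
    "continuous_on S (\<lambda>x. qIm2 (f x))" "continuous_on S (\<lambda>x. qIm3 (f x))"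
    by (simp_all only: bounded_linear.continuous_on [OF _ assms])
qed

section \<open>The spectrum\<close>

context quat_Bstar_algebra
begin

text \<open>
  The zero functional is included: it is the point at infinity that makes the set compact.
\<close>

definition quat_characters :: "('a \<Rightarrow> quat) set" where
  "quat_characters = {\<psi>. (\<forall>a b. \<psi> (a + b) = \<psi> a + \<psi> b) \<and> (\<forall>a b. \<psi> (a * b) = \<psi> a * \<psi> b) \<and>
     (\<forall>\<alpha> a. \<psi> (lscale \<alpha> a) = \<alpha> * \<psi> a) \<and> (\<forall>a \<alpha>. \<psi> (rscale a \<alpha>) = \<psi> a * \<alpha>) \<and>
     (\<forall>a. \<psi> (star a) = qcnj (\<psi> a)) \<and> (\<forall>a. norm (\<psi> a) \<le> norm a)}"

lemma quat_charactersD: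
  assumes "\<psi> \<in> quat_characters"
  shows "\<psi> (a + b) = \<psi> a + \<psi> b" "\<psi> (a * b) = \<psi> a * \<psi> b"
    "\<psi> (lscale \<alpha> a) = \<alpha> * \<psi> a" "\<psi> (rscale a \<alpha>) = \<psi> a * \<alpha>"
    "\<psi> (star a) = qcnj (\<psi> a)" "norm (\<psi> a) \<le> norm a"
  using assms unfolding quat_characters_def by blast+

lemma quat_character_linear:
  assumes "\<psi> \<in> quat_characters"
  shows "linear \<psi>"
proof (rule linearI)
  show "\<psi> (r *\<^sub>R a) = r *\<^sub>R \<psi> a" for r a
    using quat_charactersD(3) [OF assms, of "of_real r" a]
    by (simp add: lscale_of_real) (simp add: scaleR_conv_of_real)
qed (rule quat_charactersD [OF assms])

text \<open>
  The norm bound places the characters in a product of balls, compact by Tychonoff's theorem, and each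
  defining condition involves only finitely many evaluations, hence is closed.
\<close>

lemma compact_quat_characters: "compact quat_characters"
proof -
  let ?P = "\<Pi>\<^sub>E a\<in>UNIV. cball (0::quat) (norm (a::'a))"
  have "compactin (product_topology (\<lambda>_. euclidean) UNIV) ?P"
    by (simp add: compactin_PiE)
  then have "compact ?P"
    by (simp add: euclidean_product_topology)
  moreover have "closed quat_characters"
    unfolding quat_characters_def
    by (intro closed_Collect_conj closed_Collect_all closed_Collect_eq closed_Collect_le
        continuous_intros continuous_on_evaluation)
  ultimately have "compact (?P \<inter> quat_characters)"
    by (rule compact_Int_closed)
  moreover have "quat_characters \<subseteq> ?P"
    by (auto simp: quat_charactersD(6))
  ultimately show ?thesis
    by (simp add: Int_absorb1)
qed

definition spectrum :: "('a \<Rightarrow> quat) topology" where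
  "spectrum = top_of_set (quat_characters - {\<lambda>_. 0})"

lemma topspace_spectrum: "topspace spectrum = quat_characters - {\<lambda>_. 0}"
  by (simp add: spectrum_def)

lemma compactin_spectrum_ge:
  assumes "0 < e"
  shows "compactin spectrum {\<psi> \<in> quat_characters. e \<le> norm (\<psi> a)}"
proof -
  have "closed {\<psi> :: 'a \<Rightarrow> quat. e \<le> norm (\<psi> a)}"
    by (intro closed_Collect_le continuous_intros continuous_on_evaluation)
  then have "compact (quat_characters \<inter> {\<psi>. e \<le> norm (\<psi> a)})"
    by (rule compact_Int_closed [OF compact_quat_characters])
  then show ?thesis
    using assms unfolding spectrum_def compactin_subtopology Collect_conj_eq by auto
qed

lemma Hausdorff_spectrum: "Hausdorff_space spectrum"
  unfolding spectrum_def euclidean_product_topology [symmetric]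
  by (simp add: Hausdorff_space_subtopology Hausdorff_space_product_topology)

lemma locally_compact_spectrum: "locally_compact_space spectrum"
  unfolding locally_compact_space_def
proof
  fix \<psi>
  assume "\<psi> \<in> topspace spectrum"
  then have \<psi>: "\<psi> \<in> quat_characters" "\<psi> \<noteq> (\<lambda>_. 0)"
    by (auto simp: topspace_spectrum)
  then obtain a where a: "\<psi> a \<noteq> 0"
    by auto
  define e where "e = norm (\<psi> a) / 2"
  have e: "0 < e" "e < norm (\<psi> a)"
    using a by (simp_all add: e_def)
  let ?U = "{\<psi> \<in> quat_characters. e < norm (\<psi> a)}"
  have "open {\<psi> :: 'a \<Rightarrow> quat. e < norm (\<psi> a)}"
    by (intro open_Collect_less continuous_intros continuous_on_evaluation)
  then have "openin spectrum ((quat_characters - {\<lambda>_. 0}) \<inter> {\<psi>. e < norm (\<psi> a)})"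
    unfolding spectrum_def by (rule openin_open_Int)
  also have "(quat_characters - {\<lambda>_. 0}) \<inter> {\<psi>. e < norm (\<psi> a)} = ?U"
    using e by auto
  finally have "openin spectrum ?U" .
  then show "\<exists>U K. openin spectrum U \<and> compactin spectrum K \<and> \<psi> \<in> U \<and> U \<subseteq> K"
    using compactin_spectrum_ge [OF e(1), of a] e \<psi>
    by (intro exI [of _ ?U] exI [of _ "{\<psi> \<in> quat_characters. e \<le> norm (\<psi> a)}"]) auto
qed

definition gelfand :: "'a \<Rightarrow> ('a \<Rightarrow> quat) \<Rightarrow> quat" where
  "gelfand a = (\<lambda>\<psi>\<in>topspace spectrum. \<psi> a)"

lemma gelfand_in_C0: "gelfand a \<in> C0 spectrum"
proof -
  have "continuous_map spectrum euclidean (\<lambda>\<psi>. \<psi> a)"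
    unfolding spectrum_def continuous_map_iff_continuous by (rule continuous_on_evaluation)
  then have "continuous_map spectrum euclidean (gelfand a)"
    by (rule continuous_map_eq) (simp add: gelfand_def)
  moreover have "\<exists>K. compactin spectrum K \<and> (\<forall>\<psi>\<in>topspace spectrum - K. norm (gelfand a \<psi>) < e)"
    if "0 < e" for e
    using compactin_spectrum_ge [OF that, of a]
    by (intro exI [of _ "{\<psi> \<in> quat_characters. e \<le> norm (\<psi> a)}"])
      (auto simp: gelfand_def topspace_spectrum)
  ultimately show ?thesis
    by (auto simp: C0_def gelfand_def)
qed

lemma C0_norm_gelfand:
  assumes \<psi>: "\<psi> \<in> quat_characters" "norm (\<psi> a) = norm a"
  shows "C0_norm spectrum (gelfand a) = norm a"
  unfolding C0_norm_def
proof (rule cSup_eq_maximum)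
  show "norm a \<in> insert 0 ((\<lambda>x. norm (gelfand a x)) ` topspace spectrum)"
  proof (cases "norm a = 0")
    case False
    then have "\<psi> \<in> topspace spectrum"
      using \<psi> by (auto simp: topspace_spectrum)
    then show ?thesis
      using \<psi>(2) by (auto simp: gelfand_def intro!: image_eqI [of _ _ \<psi>])
  qed simp
qed (auto simp: gelfand_def topspace_spectrum quat_charactersD(6))

end

section \<open>The Gelfand transform\<close>

context normal_quat_Bstar_algebra
begin

definition extend_character :: "('a \<Rightarrow> real) \<Rightarrow> 'a \<Rightarrow> quat" where
  "extend_character \<phi> a = Quat (\<phi> (central_part a)) (\<phi> (central_part (lscale (- qI) a)))
     (\<phi> (central_part (lscale (- qJ) a))) (\<phi> (central_part (lscale (- qK) a)))"

lemma extend_character_lscale: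
  assumes "centre.character \<phi>" "x \<in> centre"
  shows "extend_character \<phi> (lscale \<gamma> x) = \<gamma> * of_real (\<phi> x)"
proof -
  have "\<phi> (central_part (lscale \<alpha> x)) = qRe \<alpha> * \<phi> x" for \<alpha>
    using assms by (simp add: central_part_lscale centre.character_def)
  then show ?thesis
    by (simp add: extend_character_def lscale_lscale)
      (simp add: of_real_quat quat_eq_iff times_quat_def uminus_quat_def)
qed

text \<open>
  All algebraic laws reduce to multiples of central elements, where the extension is \<open>\<gamma> x \<mapsto> \<gamma> \<phi> x\<close>
  and the real numbers \<open>\<phi> x\<close> commute with everything.  The norm bound follows from that of \<open>\<phi>\<close> at
  \<open>a\<^sup>* a\<close>.
\<close>

lemma extend_character_mem:
  assumes \<phi>: "centre.character \<phi>"
  shows "extend_character \<phi> \<in> quat_characters"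
proof -
  let ?\<psi> = "extend_character \<phi>"
  note ext = extend_character_lscale [OF \<phi>]
  have ext1: "?\<psi> x = of_real (\<phi> x)" if "x \<in> centre" for x
    using ext [OF that, of 1] by (simp add: scale_one)
  have add: "?\<psi> (a + b) = ?\<psi> a + ?\<psi> b" for a b
    using \<phi> central_part_in_centre unfolding centre.character_def
    by (simp add: extend_character_def lscale_add_right linear_add [OF linear_central_part]
        plus_quat_def)
  have left: "?\<psi> (lscale \<alpha> a) = \<alpha> * ?\<psi> a" for \<alpha> a
    by (induction a rule: central_induct)
      (simp_all add: ext lscale_lscale lscale_add_right add mult.assoc distrib_left)
  have right: "?\<psi> (rscale a \<alpha>) = ?\<psi> a * \<alpha>" for \<alpha> a
  proof (induction a rule: central_induct)
    case (lscale \<gamma> x)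
    have "rscale (lscale \<gamma> x) \<alpha> = lscale (\<gamma> * \<alpha>) x"
      using lscale_rscale [of \<gamma> x \<alpha>] by (simp add: centreD [OF lscale] lscale_lscale)
    then show ?case
      by (simp add: ext lscale mult.assoc of_real_commute_quat)
  qed (simp add: rscale_add_left add distrib_right)
  have mult: "?\<psi> (a * b) = ?\<psi> a * ?\<psi> b" for a b
  proof (induction a rule: central_induct)
    case x: (lscale \<alpha> x)
    show ?case
    proof (induction b rule: central_induct)
      case y: (lscale \<beta> y)
      have "\<phi> (x * y) = \<phi> x * \<phi> y"
        using \<phi> x y by (simp add: centre.character_def)
      then have "?\<psi> (lscale \<alpha> x * lscale \<beta> y) = \<alpha> * \<beta> * of_real (\<phi> x) * of_real (\<phi> y)"
        by (simp add: lscale_mult_lscale x y ext centre_mult mult.assoc)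
      also have "\<dots> = \<alpha> * of_real (\<phi> x) * (\<beta> * of_real (\<phi> y))"
        using of_real_commute_quat [of "\<phi> x" \<beta>] by (simp add: mult.assoc) (simp flip: mult.assoc)
      finally show ?case
        by (simp add: ext x y)
    qed (simp add: distrib_left add)
  qed (simp add: distrib_right add)
  have star: "?\<psi> (star a) = qcnj (?\<psi> a)" for a
    by (induction a rule: central_induct)
      (simp_all add: star_lscale_centre star_centre_id ext of_real_commute_quat star_add add)
  have "norm (?\<psi> a) \<le> norm a" for a
  proof -
    have h: "star a * a \<in> centre"
      by (rule self_adjoint_in_centre) (simp add: star_mult star_star)
    have "(norm (?\<psi> a))\<^sup>2 = norm (qcnj (?\<psi> a) * ?\<psi> a)"
      by (simp add: qcnj_mult_self norm_power)
    also have "\<dots> = \<bar>\<phi> (star a * a)\<bar>"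
      by (simp add: ext1 h flip: mult star)
    also have "\<dots> \<le> (norm a)\<^sup>2"
      using \<phi> h unfolding centre.character_def by (simp flip: norm_star_mult_self)
    finally show ?thesis
      by simp
  qed
  with add mult left right star show ?thesis
    by (simp add: quat_characters_def)
qed

lemma exists_norming_quat_character:
  obtains \<psi> where "\<psi> \<in> quat_characters" "norm (\<psi> a) = norm a"
proof -
  have h: "star a * a \<in> centre"
    by (rule self_adjoint_in_centre) (simp add: star_mult star_star)
  obtain \<phi> where \<phi>: "centre.character \<phi>" "\<bar>\<phi> (star a * a)\<bar> = norm (star a * a)"
    using centre.exists_norming_character [OF h] .
  define \<psi> where "\<psi> = extend_character \<phi>"
  have \<psi>: "\<psi> \<in> quat_characters"
    unfolding \<psi>_def by (rule extend_character_mem [OF \<phi>(1)])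
  have "(norm (\<psi> a))\<^sup>2 = norm (qcnj (\<psi> a) * \<psi> a)"
    by (simp add: qcnj_mult_self norm_power)
  also have "\<dots> = norm (\<psi> (star a * a))"
    by (simp add: quat_charactersD [OF \<psi>])
  also have "\<dots> = norm (star a * a)"
    using extend_character_lscale [OF \<phi>(1) h, of 1] \<phi>(2) by (simp add: \<psi>_def scale_one)
  also have "\<dots> = (norm a)\<^sup>2"
    by (rule norm_star_mult_self)
  finally have "norm (\<psi> a) = norm a"
    by simp
  with \<psi> show thesis
    by (rule that)
qed

lemma quat_character_centre:
  assumes "\<psi> \<in> quat_characters" "x \<in> centre"
  shows "\<psi> x = of_real (qRe (\<psi> x))"
  using quat_charactersD(5) [OF assms(1), of x]
  by (simp add: star_centre_id [OF assms(2)] flip: qcnj_fixed_iff)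

lemma quat_character_eqI:
  assumes \<psi>: "\<psi> \<in> quat_characters" and \<omega>: "\<omega> \<in> quat_characters"
    and eq: "\<And>x. x \<in> centre \<Longrightarrow> qRe (\<psi> x) = qRe (\<omega> x)"
  shows "\<psi> = \<omega>"
proof
  fix a
  show "\<psi> a = \<omega> a"
  proof (induction a rule: central_induct)
    case (lscale \<gamma> x)
    then have "\<psi> x = \<omega> x"
      using quat_character_centre [OF \<psi> lscale] quat_character_centre [OF \<omega> lscale] eq by simp
    then show ?case
      by (simp add: quat_charactersD [OF \<psi>] quat_charactersD [OF \<omega>])
  qed (simp add: quat_charactersD [OF \<psi>] quat_charactersD [OF \<omega>])
qed

lemma zero_quat_character: "(\<lambda>_. 0) \<in> quat_characters"
  by (simp add: quat_characters_def)

text \<open>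
  The functions \<open>\<psi> \<mapsto> c + \<psi> x\<close> with \<open>x\<close> central form an algebra to which the Stone--Weierstrass theorem
  applies; the constants \<open>c\<close> stand in for the missing unit.  The value at the zero character shows that
  the constant in an approximation is itself small, so it can be dropped.
\<close>

lemma real_approximation:
  assumes g: "continuous_on quat_characters g" and g0: "g (\<lambda>_. 0) = 0" and e: "0 < e"
  obtains x where "x \<in> centre" "\<And>\<psi>. \<psi> \<in> quat_characters \<Longrightarrow> norm (\<psi> x - of_real (g \<psi>)) < e"
proof -
  define R where "R = {f. \<exists>c. \<exists>x\<in>centre. \<forall>\<psi>\<in>quat_characters. f \<psi> = c + qRe (\<psi> x)}"
  have RI: "f \<in> R" if "x \<in> centre" "\<And>\<psi>. \<psi> \<in> quat_characters \<Longrightarrow> f \<psi> = c + qRe (\<psi> x)" for f c x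
    using that unfolding R_def by blast
  have "function_ring_on R quat_characters"
  proof
    show "compact quat_characters"
      by (rule compact_quat_characters)
    fix f
    assume "f \<in> R"
    then obtain c x where x: "x \<in> centre" "\<And>\<psi>. \<psi> \<in> quat_characters \<Longrightarrow> f \<psi> = c + qRe (\<psi> x)"
      unfolding R_def by blast
    have "continuous_on quat_characters (\<lambda>\<psi>. c + qRe (\<psi> x))"
      by (intro continuous_intros continuous_on_evaluation)
    then show "continuous_on quat_characters f"
      by (simp add: x(2) cong: continuous_on_cong)
    fix h
    assume "h \<in> R"
    then obtain d y where y: "y \<in> centre" "\<And>\<psi>. \<psi> \<in> quat_characters \<Longrightarrow> h \<psi> = d + qRe (\<psi> y)"
      unfolding R_def by blast
    show "(\<lambda>\<psi>. f \<psi> + h \<psi>) \<in> R"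
      by (rule RI [of "x + y" _ "c + d"])
        (simp_all add: x y centre.add_closed quat_charactersD plus_quat_def)
    have "qRe (\<psi> (x * y)) = qRe (\<psi> x) * qRe (\<psi> y)" if "\<psi> \<in> quat_characters" for \<psi>
    proof -
      have "\<psi> (x * y) = of_real (qRe (\<psi> x) * qRe (\<psi> y))"
        using quat_character_centre [OF that x(1)] quat_character_centre [OF that y(1)]
        by (simp add: quat_charactersD(2) [OF that])
      then show ?thesis
        unfolding of_real_quat by simp
    qed
    then show "(\<lambda>\<psi>. f \<psi> * h \<psi>) \<in> R"
      by (intro RI [of "x * y + d *\<^sub>R x + c *\<^sub>R y" _ "c * d"])
        (simp_all add: x y centre.add_closed centre.scale_closed centre_mult
          quat_charactersD(1) linear_scale [OF quat_character_linear]
          plus_quat_def scaleR_quat_def algebra_simps)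
  next
    show "(\<lambda>_. c) \<in> R" for c
      by (rule RI [of 0 _ c])
        (simp_all add: subspace_0 [OF subspace_centre] linear_0 [OF quat_character_linear] zero_quat_def)
  next
    fix \<psi> \<omega>
    assume "\<psi> \<in> quat_characters" "\<omega> \<in> quat_characters" "\<psi> \<noteq> \<omega>"
    then obtain x where "x \<in> centre" "qRe (\<psi> x) \<noteq> qRe (\<omega> x)"
      using quat_character_eqI by blast
    then show "\<exists>f\<in>R. f \<psi> \<noteq> f \<omega>"
      by (intro bexI [of _ "\<lambda>\<psi>. 0 + qRe (\<psi> x)"] RI) auto
  qed
  then obtain f where f: "f \<in> R" "\<And>\<psi>. \<psi> \<in> quat_characters \<Longrightarrow> \<bar>g \<psi> - f \<psi>\<bar> < e / 2"
    using function_ring_on.Stone_Weierstrass_basic [OF _ g, of R "e / 2"] e by auto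
  then obtain c x where x: "x \<in> centre" "\<And>\<psi>. \<psi> \<in> quat_characters \<Longrightarrow> f \<psi> = c + qRe (\<psi> x)"
    unfolding R_def by blast
  have "\<bar>c\<bar> < e / 2"
    using f(2) [OF zero_quat_character] x(2) [OF zero_quat_character] g0 by (simp add: zero_quat_def)
  have "norm (\<psi> x - of_real (g \<psi>)) < e" if \<psi>: "\<psi> \<in> quat_characters" for \<psi>
  proof -
    have "\<bar>qRe (\<psi> x) - g \<psi>\<bar> < e"
      using f(2) [OF \<psi>] x(2) [OF \<psi>] \<open>\<bar>c\<bar> < e / 2\<close> by linarith
    moreover have "\<psi> x - of_real (g \<psi>) = of_real (qRe (\<psi> x) - g \<psi>)"
      using quat_character_centre [OF \<psi> x(1)] by simp
    ultimately show ?thesis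
      by (simp only: norm_of_real)
  qed
  with x(1) show thesis
    by (rule that)
qed

lemma quat_approximation:
  assumes g: "continuous_on quat_characters g" and g0: "g (\<lambda>_. 0) = 0" and e: "0 < e"
  obtains a where "\<And>\<psi>. \<psi> \<in> quat_characters \<Longrightarrow> norm (\<psi> a - g \<psi>) < e"
proof -
  have e4: "0 < e / 4"
    using e by simp
  note comps = continuous_on_quat_components [OF g]
  obtain x0 where x0: "\<And>\<psi>. \<psi> \<in> quat_characters \<Longrightarrow> norm (\<psi> x0 - of_real (qRe (g \<psi>))) < e / 4"
    using real_approximation [OF comps(1) _ e4] g0 by (auto simp: zero_quat_def)
  obtain x1 where x1: "\<And>\<psi>. \<psi> \<in> quat_characters \<Longrightarrow> norm (\<psi> x1 - of_real (qIm1 (g \<psi>))) < e / 4"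
    using real_approximation [OF comps(2) _ e4] g0 by (auto simp: zero_quat_def)
  obtain x2 where x2: "\<And>\<psi>. \<psi> \<in> quat_characters \<Longrightarrow> norm (\<psi> x2 - of_real (qIm2 (g \<psi>))) < e / 4"
    using real_approximation [OF comps(3) _ e4] g0 by (auto simp: zero_quat_def)
  obtain x3 where x3: "\<And>\<psi>. \<psi> \<in> quat_characters \<Longrightarrow> norm (\<psi> x3 - of_real (qIm3 (g \<psi>))) < e / 4"
    using real_approximation [OF comps(4) _ e4] g0 by (auto simp: zero_quat_def)
  let ?a = "x0 + rscale x1 qI + rscale x2 qJ + rscale x3 qK"
  have "norm (\<psi> ?a - g \<psi>) < e" if \<psi>: "\<psi> \<in> quat_characters" for \<psi>
  proof -
    let ?d0 = "\<psi> x0 - of_real (qRe (g \<psi>))" and ?d1 = "(\<psi> x1 - of_real (qIm1 (g \<psi>))) * qI"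
    let ?d2 = "(\<psi> x2 - of_real (qIm2 (g \<psi>))) * qJ" and ?d3 = "(\<psi> x3 - of_real (qIm3 (g \<psi>))) * qK"
    have "\<psi> ?a - g \<psi> = \<psi> ?a - (of_real (qRe (g \<psi>)) + of_real (qIm1 (g \<psi>)) * qI +
        of_real (qIm2 (g \<psi>)) * qJ + of_real (qIm3 (g \<psi>)) * qK)"
      by (simp flip: quat_decompose)
    also have "\<dots> = ?d0 + ?d1 + ?d2 + ?d3"
      by (simp add: quat_charactersD [OF \<psi>] algebra_simps)
    also have "norm \<dots> \<le> norm ?d0 + norm ?d1 + norm ?d2 + norm ?d3"
      by (intro order_trans [OF norm_triangle_ineq] add_mono order_refl)
    also have "\<dots> < e"
      using x0 [OF \<psi>] x1 [OF \<psi>] x2 [OF \<psi>] x3 [OF \<psi>] by (simp add: norm_mult norm_quat_units)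
    finally show ?thesis .
  qed
  then show thesis
    by (rule that)
qed

text \<open>
  Vanishing at infinity becomes continuity at the zero character: the complement of a compact subset
  of the spectrum is a neighbourhood of that point.
\<close>

lemma C0_spectrum_extends:
  assumes f: "f \<in> C0 spectrum"
  shows "continuous_on quat_characters (\<lambda>\<psi>. if \<psi> = (\<lambda>_. 0) then 0 else f \<psi>)"
    (is "continuous_on _ ?g")
  unfolding continuous_on_def
proof
  let ?X = "quat_characters - {\<lambda>_. 0}"
  fix \<psi>
  assume \<psi>: "\<psi> \<in> quat_characters"
  show "(?g \<longlongrightarrow> ?g \<psi>) (at \<psi> within quat_characters)"
  proof (cases "\<psi> = (\<lambda>_. 0)")
    case False
    have "continuous_on ?X f"
      using f by (simp add: C0_def spectrum_def)
    then have "(f \<longlongrightarrow> ?g \<psi>) (at \<psi> within ?X)"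
      using \<psi> False by (simp add: continuous_on_def)
    then have "(?g \<longlongrightarrow> ?g \<psi>) (at \<psi> within ?X)"
      by (rule Lim_transform_eventually) (simp add: eventually_at_filter)
    also have "at \<psi> within ?X = at \<psi> within quat_characters"
      by (rule at_within_nhd [of _ "- {\<lambda>_. 0}"]) (use False in auto)
    finally show ?thesis .
  next
    case True
    show ?thesis
    proof (rule tendstoI)
      fix e :: real
      assume "0 < e"
      then obtain K where K: "compactin spectrum K"
          "\<forall>\<omega>\<in>topspace spectrum - K. norm (f \<omega>) < e"
        using f unfolding C0_def by blast
      then have "compact K" "K \<subseteq> ?X"
        by (simp_all add: spectrum_def compactin_subtopology)
      then show "\<forall>\<^sub>F \<omega> in at \<psi> within quat_characters. dist (?g \<omega>) (?g \<psi>) < e"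
        unfolding eventually_at_topological
        by (intro exI [of _ "- K"])
          (use K(2) True in \<open>auto simp: open_Compl compact_imp_closed topspace_spectrum\<close>)
    qed
  qed
qed

text \<open>
  Because of the norming characters, a sequence whose transforms converge uniformly to \<open>f\<close> is a Cauchy
  sequence in the algebra.
\<close>

lemma gelfand_surj:
  assumes f: "f \<in> C0 spectrum"
  obtains a where "gelfand a = f"
proof -
  define g where "g \<psi> = (if \<psi> = (\<lambda>_. 0) then 0 else f \<psi>)" for \<psi>
  have g: "continuous_on quat_characters g"
    unfolding g_def by (rule C0_spectrum_extends [OF f])
  have "\<exists>a. \<forall>\<psi>\<in>quat_characters. norm (\<psi> a - g \<psi>) < inverse (Suc n)" for n
  proof -
    have "g (\<lambda>_. 0) = 0" "0 < inverse (real (Suc n))"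
      by (simp_all add: g_def)
    then obtain a where "\<And>\<psi>. \<psi> \<in> quat_characters \<Longrightarrow> norm (\<psi> a - g \<psi>) < inverse (Suc n)"
      using quat_approximation [OF g] by blast
    then show ?thesis
      by blast
  qed
  then obtain s where s: "\<And>n \<psi>. \<psi> \<in> quat_characters \<Longrightarrow> norm (\<psi> (s n) - g \<psi>) < inverse (Suc n)"
    by metis
  have dist: "norm (s m - s n) < inverse (Suc m) + inverse (Suc n)" for m n
  proof -
    obtain \<psi> where \<psi>: "\<psi> \<in> quat_characters" "norm (\<psi> (s m - s n)) = norm (s m - s n)"
      by (rule exists_norming_quat_character)
    have "norm (\<psi> (s m - s n)) = norm ((\<psi> (s m) - g \<psi>) - (\<psi> (s n) - g \<psi>))"
      by (simp add: linear_diff [OF quat_character_linear [OF \<psi>(1)]])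
    also have "\<dots> \<le> norm (\<psi> (s m) - g \<psi>) + norm (\<psi> (s n) - g \<psi>)"
      by (rule norm_triangle_ineq4)
    also have "\<dots> < inverse (Suc m) + inverse (Suc n)"
      by (intro add_strict_mono s \<psi>)
    finally show ?thesis
      by (simp only: \<psi>(2))
  qed
  have "Cauchy s"
  proof (rule CauchyI)
    fix e :: real
    assume "0 < e"
    then obtain N where N: "inverse (Suc N) < e / 2"
      using reals_Archimedean [of "e / 2"] by auto
    have "norm (s m - s n) < e" if "N \<le> m" "N \<le> n" for m n
    proof -
      have "inverse (real (Suc m)) \<le> inverse (Suc N)" "inverse (real (Suc n)) \<le> inverse (Suc N)"
        using that by (simp_all add: divide_simps)
      then show ?thesis
        using dist [of m n] N by linarith
    qed
    then show "\<exists>M. \<forall>m\<ge>M. \<forall>n\<ge>M. norm (s m - s n) < e"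
      by blast
  qed
  then obtain a where a: "s \<longlonglongrightarrow> a"
    by (auto simp: Cauchy_convergent_iff convergent_def)
  have eq: "\<psi> a = g \<psi>" if \<psi>: "\<psi> \<in> quat_characters" for \<psi>
  proof (rule LIMSEQ_unique)
    have "bounded_linear \<psi>"
      by (rule bounded_linear_intro [of _ 1])
        (simp_all add: linear_add [OF quat_character_linear [OF \<psi>]]
          linear_scale [OF quat_character_linear [OF \<psi>]] quat_charactersD(6) [OF \<psi>])
    then show "(\<lambda>n. \<psi> (s n)) \<longlonglongrightarrow> \<psi> a"
      using a by (rule bounded_linear.tendsto)
    show "(\<lambda>n. \<psi> (s n)) \<longlonglongrightarrow> g \<psi>"
      by (rule LIM_zero_cancel, rule Lim_null_comparison [OF _ LIMSEQ_inverse_real_of_nat])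
        (intro always_eventually allI less_imp_le s \<psi>)
  qed
  have "gelfand a = f"
  proof
    fix \<psi>
    show "gelfand a \<psi> = f \<psi>"
    proof (cases "\<psi> \<in> topspace spectrum")
      case True
      then have "\<psi> \<in> quat_characters" "\<psi> \<noteq> (\<lambda>_. 0)"
        by (simp_all only: topspace_spectrum Diff_iff singleton_iff not_False_eq_True)
      then have "\<psi> a = f \<psi>"
        by (simp only: eq g_def if_False)
      with True show ?thesis
        by (simp only: gelfand_def restrict_apply')
    next
      case False
      have "f \<in> extensional (topspace spectrum)"
        using f by (simp add: C0_def)
      then have "f \<psi> = undefined"
        using False by (rule extensional_arb)
      with False show ?thesis
        by (simp only: gelfand_def restrict_apply if_False)
    qed
  qed
  then show thesis
    by (rule that)
qed

theorem gelfand_isomorphism: "C0_isomorphism lscale rscale star spectrum gelfand"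
  unfolding C0_isomorphism_def
proof (intro conjI allI)
  show "bij_betw gelfand UNIV (C0 spectrum)"
    unfolding bij_betw_def
  proof
    show "inj gelfand"
    proof (rule injI)
      fix a b
      assume ab: "gelfand a = gelfand b"
      obtain \<psi> where \<psi>: "\<psi> \<in> quat_characters" "norm (\<psi> (a - b)) = norm (a - b)"
        by (rule exists_norming_quat_character)
      have "\<psi> a = \<psi> b"
        using \<psi>(1) fun_cong [OF ab, of \<psi>]
        by (cases "\<psi> = (\<lambda>_. 0)") (auto simp: gelfand_def topspace_spectrum)
      then show "a = b"
        using \<psi>(2) by (simp add: linear_diff [OF quat_character_linear [OF \<psi>(1)]])
    qed
    show "range gelfand = C0 spectrum"
    proof
      show "C0 spectrum \<subseteq> range gelfand"
        by (rule subsetI, erule gelfand_surj) (rule range_eqI, rule sym)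
    qed (auto intro: gelfand_in_C0)
  qed
  show "C0_norm spectrum (gelfand a) = norm a" for a
  proof -
    obtain \<psi> where "\<psi> \<in> quat_characters" "norm (\<psi> a) = norm a"
      by (rule exists_norming_quat_character)
    then show ?thesis
      by (rule C0_norm_gelfand)
  qed
qed (rule ext, simp add: gelfand_def topspace_spectrum quat_charactersD)+

end

lemma C0_isomorphic_imp_normal:
  assumes "C0_isomorphic lscale rscale star \<Omega>"
  shows "star a * a = a * star a"
proof -
  obtain \<Phi> where \<Phi>: "C0_isomorphism lscale rscale star \<Omega> \<Phi>"
    using assms unfolding C0_isomorphic_def ..
  have "\<Phi> (star a * a) = \<Phi> (a * star a)"
    using \<Phi> by (simp add: C0_isomorphism_def qcnj_mult_self cong: restrict_cong)
  moreover have "inj \<Phi>"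
    using \<Phi> by (simp add: C0_isomorphism_def bij_betw_def)
  ultimately show ?thesis
    by (simp add: inj_eq)
qed

theorem theorem4p10:
  fixes lscale :: "quat \<Rightarrow> 'a::{banach, real_normed_algebra} \<Rightarrow> 'a"
    and rscale :: "'a \<Rightarrow> quat \<Rightarrow> 'a"
    and star :: "'a \<Rightarrow> 'a"
  assumes "quat_Bstar_algebra lscale rscale star"
  shows "((\<exists>\<Omega> :: ('a \<Rightarrow> quat) topology.
            locally_compact_space \<Omega> \<and> Hausdorff_space \<Omega> \<and>
            C0_isomorphic lscale rscale star \<Omega>)
          \<longleftrightarrow> (\<forall>a. star a * a = a * star a)) \<and>
         (\<forall>\<Omega> :: 'b topology.
            locally_compact_space \<Omega> \<and> Hausdorff_space \<Omega> \<and>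
            C0_isomorphic lscale rscale star \<Omega>
          \<longrightarrow> (\<forall>a. star a * a = a * star a))"
proof -
  interpret quat_Bstar_algebra lscale rscale star
    by (rule assms)
  have "\<exists>\<Omega> :: ('a \<Rightarrow> quat) topology. locally_compact_space \<Omega> \<and> Hausdorff_space \<Omega> \<and>
      C0_isomorphic lscale rscale star \<Omega>" if "\<forall>a. star a * a = a * star a"
  proof -
    interpret normal_quat_Bstar_algebra lscale rscale star
      by unfold_locales (use that in blast)
    show ?thesis
      using locally_compact_spectrum Hausdorff_spectrum gelfand_isomorphism
      unfolding C0_isomorphic_def by blast
  qed
  moreover have "star a * a = a * star a" if "C0_isomorphic lscale rscale star \<Omega>"
    for a and \<Omega> :: "('a \<Rightarrow> quat) topology"
    using that by (rule C0_isomorphic_imp_normal)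
  moreover have "star a * a = a * star a" if "C0_isomorphic lscale rscale star \<Omega>"
    for a and \<Omega> :: "'b topology"
    using that by (rule C0_isomorphic_imp_normal)
  ultimately show ?thesis
    by blast
qed

end
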